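(* Let $b=(b_1,b_2)\in\mathbb{R}^2\setminus\mathbb{Z}^2$ with $-1\le b_2\le b_1\le0$, and let $S=\mathbb{Z}^2+b$. Let $\gamma_1,\gamma_2,\gamma_3>0$ with $\gamma_2,\gamma_3<1$, and define $$q^1=\frac{(1,\gamma_1)}{(1,\gamma_1)\cdot(b_1+1,b_2+1)},\quad q^2=\frac{(-1,\gamma_2)}{(-1,\gamma_2)\cdot(b_1,b_2+1)},\quad q^3=\frac{(\gamma_3,-1)}{(\gamma_3,-1)\cdot(b_1,b_2)},$$ the Type 3 triangle $T=T(\gamma_1,\gamma_2,\gamma_3)=\{x\in\mathbb{R}^2: q^i\cdot x\le1,\ i=1,2,3\}$, and $$P=\Big\{(x_1,x_2,x_3)\in\mathbb{R}^2\times\mathbb{R}_+:\ q^2\cdot(x_1,x_2)\le1,\ \ q^1\cdot(x_1,x_2)+\Big(1-\tfrac{(1,\gamma_1)\cdot(b_1+1,b_2+2)}{(1,\gamma_1)\cdot(b_1+1,b_2+1)}\Big)x_3\le1,\ \ q^3\cdot(x_1,x_2)+\Big(\tfrac12-\tfrac{(\gamma_3,-1)\cdot(1+b_1,2+b_2)}{2(\gamma_3,-1)\cdot(b_1,b_2)}\Big)x_3\le1\Big\}.$$ Let $\psi(r)=\max_{i\in\{1,2,3\}}q^i\cdot r$. (i) $P$ is a pyramid whose apex $a^*=(a_1^*,a_2^*,a_3^* )$ satisfies $a_3^*>0$ if and only if $\gamma_2(2-\gamma_3+2\gamma_1\gamma_3)-\gamma_1\gamma_3>0$. (ii) Suppose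 $P$ is a pyramid with apex $a^*$ satisfying $a_3^*>0$. If $P$ is $(S\times\mathbb{Z})$-free, then $\mathcal{X}(T,p^* )+W_S=\mathbb{R}^2$ for $p^*=\frac1{a_3^*}(a_1^*,a_2^* )$. Thus, $\mathcal{L}_{\psi,p^*}$ contains a unique function.
   Context: $\mathbb{Z}_+$, $\mathbb{R}_+$ denote nonnegative integers and reals. The apex of $P$ is the common point of the three planes obtained by turning the three displayed inequalities (other than $x_3\ge0$) into equations; $P$ being a pyramid with apex $a^*$, $a_3^*>0$, means $P=\operatorname{conv}((T\times\{0\})\cup\{a^*\})$. A set $C\subseteq\mathbb{R}^d$ is $T'$-free if $\operatorname{int}(C)\cap T'=\emptyset$. $T$ is a maximal $S$-free convex $0$-neighborhood, i.e. a convex set with $0$ in its interior and no point of $S$ in its interior, maximal under inclusion with these properties. Liftings: for $k,\ell\in\mathbb{Z}_+$ (not both $0$), $R\in\mathbb{R}^{2\times k}$, $M\in\mathbb{R}^{2\times\ell}$, let $X_S(R,M)=\{(s,y)\in\mathbb{R}^k_+\times\mathbb{Z}^\ell_+: Rs+My\in S\}$. A pair $\psi,\pi:\mathbb{R}^2\to\mathbb{R}$ is a valid pair for $S$ if for all $k,\ell$, $R=(r^1,\dots,r^k)$, $M=(m^1,\dots,m^\ell)$, $\sum_i\psi(r^i)s_i+\sum_j\pi(m^j)y_j\ge1$ for all $(s,y)\in X_S(R,M)$. A lifting of $\psi$ is a $\pi:\mathbb{R}^2\to\mathbb{R}$ with $(\psi,\pi)$ a valid pair for $S$; a minimal lifting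 is one minimal under pointwise order among liftings. $V_\psi(p^* ):=\inf\{\pi(p^* ):\pi\text{ a minimal lifting of }\psi\}$ and $\mathcal{L}_{\psi,p^*}:=\{\pi\text{ a minimal lifting of }\psi:\pi(p^* )=V_\psi(p^* )\}$. Let $\Delta:=\{(r,r_3)\in\mathbb{R}^2\times\mathbb{R}_+: q^i\cdot r+(V_\psi(p^* )-q^i\cdot p^* )r_3\le1,\ i=1,2,3\}$. For $x\in\mathbb{R}^2$ the spindle is $R_T(x):=\{r\in\mathbb{R}^2:(q^i-q^k)\cdot r\le0\text{ and }(q^i-q^k)\cdot(x-r)\le0,\ i=1,2,3\}$, where $k$ is an index with $\psi(x)=q^k\cdot x$. Then $$\mathcal{X}(T,p^* ):=\bigcup_{(\bar x,\bar x_3)\in\Delta\cap(S\times\mathbb{Z}_+)}\ \bigcup_{i=0}^{\bar x_3}\big(R_T(\bar x-\bar x_3p^* )+ip^*\big).$$ $W_S:=\{w\in\mathbb{R}^2: s+\lambda w\in S\ \forall s\in S,\lambda\in\mathbb{Z}\}$, which here equals $\mathbb{Z}^2$. *)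

theory Defs
  imports "HOL-Analysis.Analysis"
begin

section \<open>Liftings\<close>

text \<open>
  A matrix with \<open>k\<close> columns is given by its column family on the indices \<open>i < k\<close>, and a vector of
  length \<open>k\<close> by its entries at those indices; values at other indices are never read. Elements of
  the set of nonnegative integers are modelled by the type \<^typ>\<open>nat\<close>.
\<close>

definition X_set ::
  "(real^2) set \<Rightarrow> nat \<Rightarrow> nat \<Rightarrow> (nat \<Rightarrow> real^2) \<Rightarrow> (nat \<Rightarrow> real^2) \<Rightarrow> ((nat \<Rightarrow> real) \<times> (nat \<Rightarrow> nat)) set"
  where
  "X_set S k l R M =
     {(s, y). (\<forall>i<k. 0 \<le> s i) \<and> (\<Sum>i<k. s i *\<^sub>R R i) + (\<Sum>j<l. real (y j) *\<^sub>R M j) \<in> S}"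

definition valid_pair :: "(real^2) set \<Rightarrow> (real^2 \<Rightarrow> real) \<Rightarrow> (real^2 \<Rightarrow> real) \<Rightarrow> bool" where
  "valid_pair S \<psi> \<pi> \<longleftrightarrow>
     (\<forall>k l R M. (k, l) \<noteq> (0, 0) \<longrightarrow>
        (\<forall>(s, y) \<in> X_set S k l R M.
           (\<Sum>i<k. \<psi> (R i) * s i) + (\<Sum>j<l. \<pi> (M j) * real (y j)) \<ge> 1))"

definition lifting :: "(real^2) set \<Rightarrow> (real^2 \<Rightarrow> real) \<Rightarrow> (real^2 \<Rightarrow> real) \<Rightarrow> bool" where
  "lifting S \<psi> \<pi> \<longleftrightarrow> valid_pair S \<psi> \<pi>"

definition minimal_lifting :: "(real^2) set \<Rightarrow> (real^2 \<Rightarrow> real) \<Rightarrow> (real^2 \<Rightarrow> real) \<Rightarrow> bool" where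
  "minimal_lifting S \<psi> \<pi> \<longleftrightarrow>
     lifting S \<psi> \<pi> \<and> (\<forall>\<pi>'. lifting S \<psi> \<pi>' \<longrightarrow> (\<forall>p. \<pi>' p \<le> \<pi> p) \<longrightarrow> \<pi>' = \<pi>)"

text \<open>
  The infimum is taken in the reals. It is meaningful because for \<open>\<psi>\<close> the gauge of a bounded
  maximal \<open>S\<close>-free convex \<open>0\<close>-neighborhood minimal liftings exist and are nonnegative.
\<close>

definition V_val :: "(real^2) set \<Rightarrow> (real^2 \<Rightarrow> real) \<Rightarrow> real^2 \<Rightarrow> real" where
  "V_val S \<psi> p = Inf {\<pi> p |\<pi>. minimal_lifting S \<psi> \<pi>}"

definition L_set :: "(real^2) set \<Rightarrow> (real^2 \<Rightarrow> real) \<Rightarrow> real^2 \<Rightarrow> (real^2 \<Rightarrow> real) set" where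
  "L_set S \<psi> p = {\<pi>. minimal_lifting S \<psi> \<pi> \<and> \<pi> p = V_val S \<psi> p}"

section \<open>Triangles, pyramids and spindles\<close>

definition free_of :: "'a::topological_space set \<Rightarrow> 'a set \<Rightarrow> bool" where
  "free_of C A \<longleftrightarrow> interior C \<inter> A = {}"

definition integer_points :: "(real^2) set" where
  "integer_points = {z. \<forall>i. z $ i \<in> \<int>}"

definition triangle :: "(3 \<Rightarrow> real^2) \<Rightarrow> (real^2) set" where
  "triangle q = {x. \<forall>i. q i \<bullet> x \<le> 1}"

definition psi :: "(3 \<Rightarrow> real^2) \<Rightarrow> real^2 \<Rightarrow> real" where
  "psi q r = Max (range (\<lambda>i. q i \<bullet> r))"

text \<open>
  The space \<open>\<real>\<^sup>2 \<times> \<real>\<close> is the product type. In \<open>pyramid q c\<close> the number \<open>c i\<close> is the coefficient of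
  the third coordinate in the \<open>i\<close>-th inequality.
\<close>

definition pyramid :: "(3 \<Rightarrow> real^2) \<Rightarrow> (3 \<Rightarrow> real) \<Rightarrow> ((real^2) \<times> real) set" where
  "pyramid q c = {(x, x3). 0 \<le> x3 \<and> (\<forall>i. q i \<bullet> x + c i * x3 \<le> 1)}"

definition is_apex :: "(3 \<Rightarrow> real^2) \<Rightarrow> (3 \<Rightarrow> real) \<Rightarrow> (real^2) \<times> real \<Rightarrow> bool" where
  "is_apex q c a \<longleftrightarrow> {(x, x3). \<forall>i. q i \<bullet> x + c i * x3 = 1} = {a}"

definition is_pyramid_with_apex :: "(3 \<Rightarrow> real^2) \<Rightarrow> (3 \<Rightarrow> real) \<Rightarrow> (real^2) \<times> real \<Rightarrow> bool" where
  "is_pyramid_with_apex q c a \<longleftrightarrow>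
     is_apex q c a \<and> pyramid q c = convex hull (triangle q \<times> {0} \<union> {a})"

definition Delta :: "(real^2) set \<Rightarrow> (3 \<Rightarrow> real^2) \<Rightarrow> real^2 \<Rightarrow> ((real^2) \<times> real) set" where
  "Delta S q p =
     {(r, r3). 0 \<le> r3 \<and> (\<forall>i. q i \<bullet> r + (V_val S (psi q) p - q i \<bullet> p) * r3 \<le> 1)}"

text \<open>
  If the maximum \<open>psi q x\<close> is attained at several indices, each of them defines the same spindle,
  so the existential quantifier over \<open>k\<close> amounts to an arbitrary choice.
\<close>

definition spindle :: "(3 \<Rightarrow> real^2) \<Rightarrow> real^2 \<Rightarrow> (real^2) set" where
  "spindle q x =
     {r. \<exists>k. psi q x = q k \<bullet> x \<and>
         (\<forall>i. (q i - q k) \<bullet> r \<le> 0 \<and> (q i - q k) \<bullet> (x - r) \<le> 0)}"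

definition X_region :: "(real^2) set \<Rightarrow> (3 \<Rightarrow> real^2) \<Rightarrow> real^2 \<Rightarrow> (real^2) set" where
  "X_region S q p =
     (\<Union>(x, n) \<in> {(x, n::nat). x \<in> S \<and> (x, real n) \<in> Delta S q p}.
        \<Union>i\<in>{0..n}. (\<lambda>r. r + real i *\<^sub>R p) ` spindle q (x - real n *\<^sub>R p))"

definition W_set :: "(real^2) set \<Rightarrow> (real^2) set" where
  "W_set S = {w. \<forall>s\<in>S. \<forall>m::int. s + of_int m *\<^sub>R w \<in> S}"

section \<open>The Type 3 triangle\<close>

text \<open>
  The points \<open>b + (1, 1)\<close>, \<open>b + (0, 1)\<close> and \<open>b\<close> of the shifted lattice lie on the respective sides
  of the triangle. The heights are those of the pyramid whose first and third facets contain
  \<open>(b + (1, 2), 1)\<close> and \<open>(b + (1, 2), 2)\<close>, and whose second facet is vertical.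
\<close>

definition type3_normal :: "real^2 \<Rightarrow> real \<Rightarrow> real \<Rightarrow> real \<Rightarrow> 3 \<Rightarrow> real^2" where
  "type3_normal b \<gamma>1 \<gamma>2 \<gamma>3 i =
     (if i = 1 then
        (1 / (vector [1, \<gamma>1] \<bullet> (vector [b$1 + 1, b$2 + 1] :: real^2))) *\<^sub>R vector [1, \<gamma>1]
      else if i = 2 then
        (1 / (vector [-1, \<gamma>2] \<bullet> (vector [b$1, b$2 + 1] :: real^2))) *\<^sub>R vector [-1, \<gamma>2]
      else
        (1 / (vector [\<gamma>3, -1] \<bullet> (vector [b$1, b$2] :: real^2))) *\<^sub>R vector [\<gamma>3, -1])"

definition type3_height :: "real^2 \<Rightarrow> real \<Rightarrow> real \<Rightarrow> real \<Rightarrow> 3 \<Rightarrow> real" where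
  "type3_height b \<gamma>1 \<gamma>2 \<gamma>3 i =
     (if i = 1 then
        1 - (vector [1, \<gamma>1] \<bullet> (vector [b$1 + 1, b$2 + 2] :: real^2)) /
            (vector [1, \<gamma>1] \<bullet> (vector [b$1 + 1, b$2 + 1] :: real^2))
      else if i = 2 then 0
      else
        1 / 2 - (vector [\<gamma>3, -1] \<bullet> (vector [1 + b$1, 2 + b$2] :: real^2)) /
                (2 * (vector [\<gamma>3, -1] \<bullet> (vector [b$1, b$2] :: real^2))))"

end

theory Submission
  imports Defs
begin

text \<open>
  Let \<open>V\<close> be the reciprocal of the height of the apex, so that \<open>q i \<bullet> p = V - c i\<close>. Freeness of the
  pyramid at the point \<open>(b + (1, 3), 3)\<close> forces \<open>2 * \<gamma>2 \<ge> 1\<close>, and nothing else is needed from it.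
  For \<open>r0\<close> in the plane choose a lattice vector \<open>z\<close> and \<open>i \<in> {0, 1}\<close> minimising
  \<open>psi q (r0 - z - i *\<^sub>R p) + i * V\<close>, with \<open>i = 0\<close> in case of a tie. Comparing with finitely many
  neighbouring pairs \<open>(z, i)\<close> shows that the minimiser \<open>r0 - z - i *\<^sub>R p\<close> lies in the spindle of one of
  the points \<open>(b, 0)\<close>, \<open>(b + (0, 1), 0)\<close>, \<open>(b + (1, 1), 0)\<close>, \<open>(b + (0, 1), 1)\<close>, \<open>(b + (1, 2), 1)\<close>,
  \<open>(b + (1, 2), 2)\<close> of the pyramid. The differences \<open>q i - q k\<close> measure these spindles
  independently of \<open>b\<close>, up to the scaling of the normals.

  On a spindle every lifting with value at most \<open>V\<close> at \<open>p\<close> is bounded below by the trivial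
  lifting, and every minimal lifting is bounded above by it.
\<close>

section \<open>Sublinearity of the gauge and spindles\<close>

lemma psi_ge: "q k \<bullet> r \<le> psi q r"
  unfolding psi_def by (rule Max_ge) auto

lemma psi_le_iff: "psi q r \<le> c \<longleftrightarrow> (\<forall>k. q k \<bullet> r \<le> c)"
  unfolding psi_def by (subst Max_le_iff) auto

lemma psi_attained: "\<exists>k. psi q r = q k \<bullet> r"
proof -
  have "psi q r \<in> range (\<lambda>i. q i \<bullet> r)"
    unfolding psi_def by (rule Max_in) auto
  then show ?thesis by auto
qed

lemma psi_zero [simp]: "psi q 0 = 0"
  using psi_attained [of q 0] by simp

lemma psi_add_le: "psi q (x + y) \<le> psi q x + psi q y"
  unfolding psi_le_iff by (auto simp: inner_add_right intro: add_mono psi_ge)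

lemma psi_scaleR_le: "0 \<le> t \<Longrightarrow> psi q (t *\<^sub>R x) \<le> t * psi q x"
  unfolding psi_le_iff by (auto intro: mult_left_mono psi_ge)

lemma psi_sum_le:
  assumes "\<And>i. i < k \<Longrightarrow> 0 \<le> t i"
  shows "psi q (\<Sum>i<(k::nat). t i *\<^sub>R x i) \<le> (\<Sum>i<k. psi q (x i) * t i)"
  using assms
proof (induction k)
  case (Suc k)
  have "psi q (\<Sum>i<Suc k. t i *\<^sub>R x i)
      \<le> psi q (\<Sum>i<k. t i *\<^sub>R x i) + psi q (t k *\<^sub>R x k)"
    by (simp add: psi_add_le)
  also have "\<dots> \<le> (\<Sum>i<k. psi q (x i) * t i) + psi q (x k) * t k"
    using Suc psi_scaleR_le [of "t k" q "x k"] by (intro add_mono) (auto simp: mult.commute)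
  finally show ?case by simp
qed simp

text \<open>Both \<open>r\<close> and \<open>x - r\<close> lie in the cone where \<open>q k\<close>
  attains the maximum, and \<open>psi q\<close> is linear on that cone.\<close>

lemma spindle_psi_add:
  assumes "r \<in> spindle q x"
  shows "psi q r + psi q (x - r) = psi q x"
proof -
  obtain k where k: "psi q x = q k \<bullet> x"
    "\<And>i. (q i - q k) \<bullet> r \<le> 0" "\<And>i. (q i - q k) \<bullet> (x - r) \<le> 0"
    using assms unfolding spindle_def by auto
  have "psi q r \<le> q k \<bullet> r" "psi q (x - r) \<le> q k \<bullet> (x - r)"
    using k(2,3) unfolding psi_le_iff by (simp_all add: inner_diff_left)
  then show ?thesis
    using psi_add_le [of q r "x - r"] k(1) by (simp add: inner_diff_right)
qed

lemma spindleI: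
  assumes "\<And>i. q i \<bullet> r \<le> q k \<bullet> r" "\<And>i. q i \<bullet> (x - r) \<le> q k \<bullet> (x - r)"
  shows "r \<in> spindle q x" "psi q x = q k \<bullet> x"
proof -
  have "q i \<bullet> x \<le> q k \<bullet> x" for i
    using assms(1) [of i] assms(2) [of i] by (simp add: inner_diff_right)
  then show *: "psi q x = q k \<bullet> x"
    by (intro antisym psi_ge) (simp add: psi_le_iff)
  show "r \<in> spindle q x"
    unfolding spindle_def using assms * by (auto simp: inner_diff_left intro!: exI [of _ k])
qed

section \<open>Liftings and the fixing region\<close>

text \<open>Sublinearity of \<open>psi q\<close> merges all continuous variables into a single
  column with weight 1, so \<open>k\<close> and \<open>R\<close> disappear from the later
  arguments.\<close>

lemma lifting_psi_iff:
  "lifting S (psi q) \<pi> \<longleftrightarrow>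
     (\<forall>r (l::nat) M y. r + (\<Sum>j<l. real (y j) *\<^sub>R M j) \<in> S \<longrightarrow>
        1 \<le> psi q r + (\<Sum>j<l. \<pi> (M j) * real (y j)))" (is "?L \<longleftrightarrow> ?R")
proof
  assume L: ?L
  show ?R
  proof (intro allI impI)
    fix r and l :: nat and M :: "nat \<Rightarrow> real^2" and y
    assume "r + (\<Sum>j<l. real (y j) *\<^sub>R M j) \<in> S"
    then have "((\<lambda>_. 1), y) \<in> X_set S 1 l (\<lambda>_. r) M"
      by (simp add: X_set_def)
    from L [unfolded lifting_def valid_pair_def, rule_format, OF _ this]
    show "1 \<le> psi q r + (\<Sum>j<l. \<pi> (M j) * real (y j))"
      by simp
  qed
next
  assume R: ?R
  have "1 \<le> (\<Sum>i<k. psi q (R i) * s i) + (\<Sum>j<l. \<pi> (M j) * real (y j))"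
    if "(s, y) \<in> X_set S k l R M" for k l R M s y
  proof -
    have "1 \<le> psi q (\<Sum>i<k. s i *\<^sub>R R i) + (\<Sum>j<l. \<pi> (M j) * real (y j))"
      using R that unfolding X_set_def by blast
    moreover have "psi q (\<Sum>i<k. s i *\<^sub>R R i) \<le> (\<Sum>i<k. psi q (R i) * s i)"
      using that by (intro psi_sum_le) (auto simp: X_set_def)
    ultimately show ?thesis by linarith
  qed
  then show ?L
    unfolding lifting_def valid_pair_def by auto
qed

lemma W_set_add: "w \<in> W_set S \<Longrightarrow> s \<in> S \<Longrightarrow> s + w \<in> S"
  unfolding W_set_def by (metis (mono_tags, lifting) mem_Collect_eq of_int_1 scaleR_one)

lemma W_set_diff_sum:
  assumes "\<And>j. w j \<in> W_set S" "s \<in> S"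
  shows "s - (\<Sum>j<(l::nat). real (y j) *\<^sub>R w j) \<in> S"
proof (induction l)
  case (Suc l)
  have "(s - (\<Sum>j<l. real (y j) *\<^sub>R w j)) + of_int (- int (y l)) *\<^sub>R w l \<in> S"
    using Suc assms(1) [of l] unfolding W_set_def by blast
  then show ?case by (simp add: algebra_simps)
qed (use assms in simp)

text \<open>Each integer column splits into a translation from \<open>W_set S\<close>, copies of
  \<open>p\<close> and a remainder. Translations do not leave \<open>S\<close>, the copies of
  \<open>p\<close> add up to a total \<open>N\<close>, and the remainders join the continuous part
  by sublinearity; validity is then \<open>free\<close> at height \<open>N\<close>.\<close>

lemma lifting_of_representation:
  assumes free: "\<And>s n. s \<in> S \<Longrightarrow> 1 \<le> psi q (s - real n *\<^sub>R p) + real n * V"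
    and rep: "\<And>m. \<exists>w\<in>W_set S. \<exists>i::nat. \<pi> m = psi q (m - w - real i *\<^sub>R p) + real i * V"
  shows "lifting S (psi q) \<pi>"
  unfolding lifting_psi_iff
proof (intro allI impI)
  fix r and l :: nat and M :: "nat \<Rightarrow> real^2" and y
  assume S: "r + (\<Sum>j<l. real (y j) *\<^sub>R M j) \<in> S"
  obtain w i where w: "\<And>m. w m \<in> W_set S"
    and \<pi>: "\<And>m. \<pi> m = psi q (m - w m - real (i m) *\<^sub>R p) + real (i m) * V"
    using rep by metis
  define N where "N = (\<Sum>j<l. y j * i (M j))"
  define u where "u j = M j - w (M j) - real (i (M j)) *\<^sub>R p" for j
  have "(r + (\<Sum>j<l. real (y j) *\<^sub>R M j)) - (\<Sum>j<l. real (y j) *\<^sub>R w (M j)) \<in> S"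
    by (rule W_set_diff_sum [OF w S])
  from free [OF this, of N]
  have "1 \<le> psi q ((r + (\<Sum>j<l. real (y j) *\<^sub>R M j)) - (\<Sum>j<l. real (y j) *\<^sub>R w (M j)) - real N *\<^sub>R p)
      + real N * V" .
  also have "(r + (\<Sum>j<l. real (y j) *\<^sub>R M j)) - (\<Sum>j<l. real (y j) *\<^sub>R w (M j)) - real N *\<^sub>R p
      = r + (\<Sum>j<l. real (y j) *\<^sub>R u j)"
    unfolding u_def N_def
    by (simp add: scaleR_right_diff_distrib sum_subtractf scaleR_left.sum)
  finally have "1 \<le> psi q (r + (\<Sum>j<l. real (y j) *\<^sub>R u j)) + real N * V" .
  moreover have "psi q (r + (\<Sum>j<l. real (y j) *\<^sub>R u j)) \<le> psi q r + (\<Sum>j<l. psi q (u j) * real (y j))"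
    using psi_add_le [of q r "\<Sum>j<l. real (y j) *\<^sub>R u j"]
      psi_sum_le [of l "\<lambda>j. real (y j)" q u] by simp
  moreover have "(\<Sum>j<l. \<pi> (M j) * real (y j)) = (\<Sum>j<l. psi q (u j) * real (y j)) + real N * V"
    unfolding \<pi> u_def N_def by (simp add: algebra_simps sum.distrib sum_distrib_left sum_distrib_right)
  ultimately show "1 \<le> psi q r + (\<Sum>j<l. \<pi> (M j) * real (y j))"
    by linarith
qed

text \<open>The cost of replacing \<open>m\<close> by a translation, \<open>i\<close> copies of
  \<open>p\<close> and a continuous remainder is always an admissible value at \<open>m\<close>. For
  \<open>m = p\<close> the copies of \<open>p\<close> are still charged at the old value.\<close>

lemma lifting_fun_upd:
  assumes L: "lifting S (psi q) \<pi>" and w: "w \<in> W_set S"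
  shows "lifting S (psi q) (\<pi>(m := psi q (m - w - real i *\<^sub>R p) + real i * \<pi> p))"
    (is "lifting S (psi q) ?\<pi>")
  unfolding lifting_psi_iff
proof (intro allI impI)
  fix r and l :: nat and M :: "nat \<Rightarrow> real^2" and y
  assume S: "r + (\<Sum>j<l. real (y j) *\<^sub>R M j) \<in> S"
  define t where "t j = (if M j = m then real (y j) else 0)" for j
  define y' where "y' j = (if M j = m then y j * i else y j)" for j
  define M' where "M' j = (if M j = m then p else M j)" for j
  define u where "u = m - w - real i *\<^sub>R p"
  have "(r + (\<Sum>j<l. real (y j) *\<^sub>R M j)) - (\<Sum>j<l. real (if M j = m then y j else 0) *\<^sub>R w) \<in> S"
    by (rule W_set_diff_sum [OF w S])
  moreover have "(r + (\<Sum>j<l. real (y j) *\<^sub>R M j)) - (\<Sum>j<l. real (if M j = m then y j else 0) *\<^sub>R w)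
      = (r + (\<Sum>j<l. t j *\<^sub>R u)) + (\<Sum>j<l. real (y' j) *\<^sub>R M' j)"
  proof -
    have "(\<Sum>j<l. real (y j) *\<^sub>R M j - real (if M j = m then y j else 0) *\<^sub>R w)
      = (\<Sum>j<l. t j *\<^sub>R u + real (y' j) *\<^sub>R M' j)"
      by (rule sum.cong) (auto simp: t_def y'_def M'_def u_def algebra_simps)
    then show ?thesis by (simp add: sum.distrib sum_subtractf algebra_simps)
  qed
  ultimately have "1 \<le> psi q (r + (\<Sum>j<l. t j *\<^sub>R u)) + (\<Sum>j<l. \<pi> (M' j) * real (y' j))"
    using L unfolding lifting_psi_iff by simp
  moreover have t: "0 \<le> t j" for j
    by (simp add: t_def)
  have "psi q (r + (\<Sum>j<l. t j *\<^sub>R u)) \<le> psi q r + (\<Sum>j<l. psi q u * t j)"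
    using psi_add_le [of q r "\<Sum>j<l. t j *\<^sub>R u"] psi_sum_le [of l t q "\<lambda>_. u", OF t] by linarith
  moreover have "(\<Sum>j<l. ?\<pi> (M j) * real (y j)) = (\<Sum>j<l. psi q u * t j + \<pi> (M' j) * real (y' j))"
    by (rule sum.cong) (auto simp: t_def y'_def M'_def u_def algebra_simps)
  ultimately show "1 \<le> psi q r + (\<Sum>j<l. ?\<pi> (M j) * real (y j))"
    by (simp add: sum.distrib)
qed

text \<open>Otherwise \<open>lifting_fun_upd\<close> would produce a strictly smaller
  lifting.\<close>

lemma minimal_lifting_le:
  assumes min: "minimal_lifting S (psi q) \<pi>" and w: "w \<in> W_set S"
  shows "\<pi> m \<le> psi q (m - w - real i *\<^sub>R p) + real i * \<pi> p"
proof (rule ccontr)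
  let ?v = "psi q (m - w - real i *\<^sub>R p) + real i * \<pi> p"
  assume less: "\<not> ?thesis"
  have "lifting S (psi q) (\<pi>(m := ?v))"
    using min w by (intro lifting_fun_upd) (auto simp: minimal_lifting_def)
  moreover have "\<forall>x. (\<pi>(m := ?v)) x \<le> \<pi> x"
    using less by auto
  ultimately have "\<pi>(m := ?v) = \<pi>"
    using min unfolding minimal_lifting_def by blast
  then show False
    using less by (metis fun_upd_same order_refl)
qed

text \<open>Validity is tested on one copy of \<open>r\<close>, \<open>n - i\<close> copies of
  \<open>p\<close> and a continuous remainder, which add up to \<open>x + w\<close>. Additivity of
  \<open>psi q\<close> on the spindle turns the cost of the remainder into the claimed
  bound.\<close>

lemma lifting_lower_bound:
  assumes L: "lifting S (psi q) \<pi>" and p: "\<pi> p \<le> V" and w: "w \<in> W_set S" and x: "x \<in> S"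
    and "i \<le> n" and le: "psi q (x - real n *\<^sub>R p) + real n * V \<le> 1"
    and mem: "r - w - real i *\<^sub>R p \<in> spindle q (x - real n *\<^sub>R p)"
  shows "psi q (r - w - real i *\<^sub>R p) + real i * V \<le> \<pi> r"
proof -
  define r' where "r' = r - w - real i *\<^sub>R p"
  define M where "M j = (if j = 0 then r else p)" for j :: nat
  define y where "y j = (if j = 0 then 1 else n - i)" for j :: nat
  have "(x - real n *\<^sub>R p - r') + (\<Sum>j<2. real (y j) *\<^sub>R M j) = x + w"
    using \<open>i \<le> n\<close> by (simp add: r'_def M_def y_def numeral_2_eq_2 of_nat_diff algebra_simps)
  then have "(x - real n *\<^sub>R p - r') + (\<Sum>j<2. real (y j) *\<^sub>R M j) \<in> S"
    using W_set_add [OF w x] by (simp only:)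
  then have "1 \<le> psi q (x - real n *\<^sub>R p - r') + (\<Sum>j<2. \<pi> (M j) * real (y j))"
    using L unfolding lifting_psi_iff by blast
  then have "1 \<le> psi q (x - real n *\<^sub>R p - r') + \<pi> r + real (n - i) * \<pi> p"
    by (simp add: M_def y_def numeral_2_eq_2 mult.commute)
  moreover have "real (n - i) * \<pi> p \<le> real n * V - real i * V"
    using mult_left_mono [OF p, of "real (n - i)"] \<open>i \<le> n\<close> by (simp add: of_nat_diff algebra_simps)
  ultimately show ?thesis
    using spindle_psi_add [OF mem] le unfolding r'_def by linarith
qed

text \<open>
  On the fixing region the lower bound of \<open>lifting_lower_bound\<close> meets the upper bound of
  \<open>minimal_lifting_le\<close>. The same lower bound shows that any function realised by the covering is
  already minimal, so no appeal to Zorn's lemma is needed for existence.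
\<close>

theorem unique_minimal_lifting:
  assumes free: "\<And>s n. s \<in> S \<Longrightarrow> 1 \<le> psi q (s - real n *\<^sub>R p) + real n * V"
    and tight: "x0 \<in> S" "0 < n0" "psi q (x0 - real n0 *\<^sub>R p) + real n0 * V = 1"
    and cover: "\<And>r. \<exists>w\<in>W_set S. \<exists>x\<in>S. \<exists>n. \<exists>i\<le>n. psi q (x - real n *\<^sub>R p) + real n * V \<le> 1 \<and>
                  r - w - real i *\<^sub>R p \<in> spindle q (x - real n *\<^sub>R p)"
  shows "V_val S (psi q) p = V" "\<exists>!\<pi>. \<pi> \<in> L_set S (psi q) p"
proof -
  have V_le: "V \<le> \<pi> p" if "lifting S (psi q) \<pi>" for \<pi>
  proof -
    \<comment> \<open>The tight point consists of \<open>n0\<close> copies of \<open>p\<close> and a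
      continuous remainder, so a value below \<open>V\<close> at \<open>p\<close> would violate
      validity.\<close>
    have "(x0 - real n0 *\<^sub>R p) + (\<Sum>j<1::nat. real n0 *\<^sub>R p) \<in> S"
      using tight by simp
    then have "1 \<le> psi q (x0 - real n0 *\<^sub>R p) + (\<Sum>j<1::nat. \<pi> p * real n0)"
      using that unfolding lifting_psi_iff by fast
    then have "1 \<le> psi q (x0 - real n0 *\<^sub>R p) + real n0 * \<pi> p"
      by (simp add: mult.commute)
    with tight(3) have "real n0 * V \<le> real n0 * \<pi> p"
      by linarith
    then show ?thesis
      using tight by simp
  qed
  obtain w x n i where wS: "\<And>r. w r \<in> W_set S" and xS: "\<And>r. x r \<in> S" and i: "\<And>r. i r \<le> n r"
    and le: "\<And>r. psi q (x r - real (n r) *\<^sub>R p) + real (n r) * V \<le> 1"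
    and mem: "\<And>r. r - w r - real (i r) *\<^sub>R p \<in> spindle q (x r - real (n r) *\<^sub>R p)"
    using cover by metis
  define f where "f r = psi q (r - w r - real (i r) *\<^sub>R p) + real (i r) * V" for r
  \<comment> \<open>A lifting below \<open>g\<close> has value at most \<open>V\<close> at
    \<open>p\<close>, as \<open>lower\<close> demands. The prescribed value is represented by
    \<open>w = 0\<close> and \<open>i = 1\<close>.\<close>
  define g where "g = f(p := V)"
  have lower: "f r \<le> \<pi> r" if "lifting S (psi q) \<pi>" "\<pi> p \<le> V" for \<pi> r
    unfolding f_def by (rule lifting_lower_bound [OF that wS xS i le mem])
  have "lifting S (psi q) g"
  proof (rule lifting_of_representation [where p = p and V = V, OF free])
    fix m
    show "\<exists>w\<in>W_set S. \<exists>i::nat. g m = psi q (m - w - real i *\<^sub>R p) + real i * V"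
    proof (cases "m = p")
      case True
      have "0 \<in> W_set S" by (simp add: W_set_def)
      with True show ?thesis
        by (intro bexI [of _ 0] exI [of _ 1]) (simp_all add: g_def)
    next
      case False
      then show ?thesis
        using wS unfolding g_def f_def by auto
    qed
  qed
  moreover have "g r \<le> \<pi> r" if "lifting S (psi q) \<pi>" "\<pi> p \<le> V" for \<pi> r
    using lower [OF that] V_le [OF that(1)] by (simp add: g_def)
  ultimately have min: "minimal_lifting S (psi q) g"
    unfolding minimal_lifting_def
    by (metis antisym ext fun_upd_same g_def)
  have gp: "g p = V" by (simp add: g_def)
  show V: "V_val S (psi q) p = V"
    unfolding V_val_def
    by (rule cInf_eq_minimum) (use min gp V_le in \<open>auto simp: minimal_lifting_def\<close>)
  show "\<exists>!\<pi>. \<pi> \<in> L_set S (psi q) p"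
  proof (rule ex1I)
    show "g \<in> L_set S (psi q) p"
      using min gp V by (simp add: L_set_def)
    fix \<pi> assume "\<pi> \<in> L_set S (psi q) p"
    then have \<pi>: "minimal_lifting S (psi q) \<pi>" "lifting S (psi q) \<pi>" "\<pi> p = V"
      using V by (auto simp: L_set_def minimal_lifting_def)
    have "\<pi> r = f r" for r
      using lower [OF \<pi>(2)] \<pi>(3) minimal_lifting_le [OF \<pi>(1) wS, where m = r and i = "i r" and p = p]
      by (intro antisym) (auto simp: f_def)
    then show "\<pi> = g"
      using \<pi>(3) by (auto simp: g_def)
  qed
qed


section \<open>The covering property of the Type 3 triangle\<close>

text \<open>
  Here \<open>A1\<close>, \<open>A2\<close>, \<open>A3\<close> stand for \<open>q k \<bullet> r\<close>, where \<open>r = r0 - z - i *\<^sub>R p\<close> is the minimiser, the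
  \<open>e\<close>'s are the scaling factors of the normals and \<open>g1 = e1 * \<gamma>1\<close>, \<open>g2 = e2 * \<gamma>2\<close>, \<open>g3 = e3 * \<gamma>3\<close>.
  Each hypothesis \<open>m1\<close>, \<open>m2\<close>, \<dots> is the comparison with one neighbour of \<open>(z, i)\<close>; the
  alternatives of the conclusion are spindles. The second lemma is the case \<open>i = 1\<close>, where the
  tie-break makes comparisons with \<open>i = 0\<close> strict.
\<close>

lemma cell0_cases:
  fixes A1 A2 A3 e1 e2 e3 g1 g2 g3 :: real
  defines "M \<equiv> max A1 (max A2 A3)"
  assumes pos: "0 < e1" "0 < g1" "0 < g2" "g2 < e2" "0 < g3" "g3 < e3"
    and m1: "M \<le> A1 - e1 \<or> M \<le> A2 + e2 \<or> M \<le> A3 - g3"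
    and m2: "M \<le> A1 - g1 \<or> M \<le> A2 \<or> M \<le> A3 + (e3 - g3/2)"
    and m3: "M \<le> A1 - (e1 + g1) \<or> M \<le> A2 + (e2 - g2) \<or> M \<le> A3 + (e3 - g3)"
    and m4: "M \<le> A1 - g1 \<or> M \<le> A2 - g2 \<or> M \<le> A3 + e3"
    and m5: "M \<le> A1 + (e1 + g1) \<or> M \<le> A2 - (e2 - g2) \<or> M \<le> A3 - (e3 - g3)"
    and m6: "M \<le> A1 + e1 \<or> M \<le> A2 - (e2 - g2) \<or> M \<le> A3 + g3/2"
    and m7: "M \<le> A1 + g1 \<or> M \<le> A2 + g2 \<or> M \<le> A3 - e3"
    and m8: "M \<le> A1 \<or> M \<le> A2 + g2 \<or> M \<le> A3 - g3/2"
  shows "A2 \<le> A1 \<and> A3 \<le> A1 \<and> A1 - A2 \<le> e2 \<and> A1 - A3 \<le> e3 - g3 \<or>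
         A2 \<le> A1 \<and> A3 \<le> A1 \<and> A1 - A2 \<le> e2 - g2 \<and> A1 - A3 \<le> e3 - g3/2 \<or>
         A1 \<le> A2 \<and> A3 \<le> A2 \<and> A2 - A1 \<le> e1 \<and> A2 - A3 \<le> e3 \<or>
         A1 \<le> A2 \<and> A3 \<le> A2 \<and> A2 - A1 \<le> e1 + g1 \<and> A2 - A3 \<le> g3/2 \<or>
         A1 \<le> A3 \<and> A2 \<le> A3 \<and> A3 - A1 \<le> e1 + g1 \<and> A3 - A2 \<le> g2"
proof -
  consider "M = A1" "A2 \<le> A1" "A3 \<le> A1" | "M = A2" "A1 \<le> A2" "A3 \<le> A2" | "M = A3" "A1 \<le> A3" "A2 \<le> A3"
    unfolding M_def by linarith
  then show ?thesis
  proof cases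
    case 1
    have le: "A1 - A2 \<le> e2" "A1 - A3 \<le> e3"
      and "A1 \<le> A2 \<or> A1 - A3 \<le> e3 - g3/2" "A1 - A2 \<le> e2 - g2 \<or> A1 - A3 \<le> e3 - g3"
      using 1 pos m1 m2 m3 m4 by auto
    \<comment> \<open>In the tie \<open>A1 = A2\<close> the point is assigned to the third
      alternative of the conclusion.\<close>
    then consider "A1 \<le> A2" | "A1 - A3 \<le> e3 - g3/2" "A1 - A2 \<le> e2 - g2" | "A1 - A3 \<le> e3 - g3"
      by blast
    then show ?thesis
      by cases (use 1 pos le in simp_all)
  next
    case 2
    have "A2 - A3 \<le> e3" "A2 - A1 \<le> e1 + g1" "A2 - A1 \<le> e1 \<or> A2 - A3 \<le> g3/2"
      using 2 pos m4 m5 m6 by auto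
    with 2 show ?thesis by auto
  next
    case 3
    have "A3 - A1 \<le> e1 + g1" "A3 - A2 \<le> e2"
      "A3 - A1 \<le> g1 \<or> A3 - A2 \<le> g2" "A3 \<le> A1 \<or> A3 - A2 \<le> g2"
      using 3 pos m1 m5 m7 m8 by auto
    \<comment> \<open>If \<open>A3 - A2\<close> exceeds \<open>g2\<close>, then \<open>m8\<close>
      forces the tie \<open>A1 = A3\<close>, and the first alternative of the conclusion
      applies.\<close>
    then consider "A3 - A1 \<le> e1 + g1" "A3 - A2 \<le> g2" | "A3 \<le> A1" "A3 - A2 \<le> e2"
      using m1 3 pos by fastforce
    then show ?thesis
      by cases (use 3 pos in simp_all)
  qed
qed

lemma cell1_cases:
  fixes A1 A2 A3 e1 e2 e3 g1 g2 g3 :: real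
  defines "M \<equiv> max A1 (max A2 A3)"
  assumes pos: "0 < e1" "0 < g1" "0 < g2" "g2 < e2" "0 < g3" "g3 < e3" "e2 \<le> 2 * g2"
    and m1: "M < A1 - e1 \<or> M < A2 + (e2 - g2) \<or> M < A3 - g3/2"
    and m2: "M < A1 - (e1 + g1) \<or> M < A2 - (2 * g2 - e2) \<or> M < A3 + (e3 - g3/2)"
    and m3: "M \<le> A1 + (e1 + g1) \<or> M \<le> A2 - (e2 - g2) \<or> M \<le> A3 - (e3 - g3)"
    and m4: "M < A1 \<or> M < A2 - g2 \<or> M < A3 + g3/2"
    and m5: "M < A1 + g1 \<or> M < A2 \<or> M < A3 - (e3 - g3/2)"
  shows "A2 \<le> A1 \<and> A3 \<le> A1 \<and> A1 - A2 \<le> e2 - g2 \<and> A1 - A3 \<le> e3 - g3/2 \<or>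
         A1 \<le> A2 \<and> A3 \<le> A2 \<and> A2 - A1 \<le> e1 + g1 \<and> A2 - A3 \<le> g3/2 \<or>
         A1 \<le> A3 \<and> A2 \<le> A3 \<and> A3 - A1 \<le> g1 \<and> A3 - A2 \<le> e2 - g2"
proof -
  consider "M = A1" "A2 \<le> A1" "A3 \<le> A1" | "M = A2" "A1 \<le> A2" "A3 \<le> A2" | "M = A3" "A1 \<le> A3" "A2 \<le> A3"
    unfolding M_def by linarith
  then show ?thesis
  proof cases
    case 1
    \<comment> \<open>Here \<open>e2 \<le> 2 * g2\<close> excludes the middle option of
      \<open>m2\<close>.\<close>
    have "A1 - A2 \<le> e2 - g2" "A1 - A3 \<le> e3 - g3/2"
      using 1 pos m1 m2 by auto
    with 1 show ?thesis by simp
  next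
    case 2
    \<comment> \<open>Strictness matters: \<open>M \<le> A1\<close> in \<open>m4\<close> would be
      compatible with a tie. The same holds for \<open>A2\<close> and \<open>m5\<close> in the next
      case.\<close>
    have "A2 - A1 \<le> e1 + g1" "A2 - A3 \<le> g3/2"
      using 2 pos m3 m4 by auto
    with 2 show ?thesis by simp
  next
    case 3
    have "A3 - A1 \<le> g1" "A3 - A2 \<le> e2 - g2"
      using 3 pos m1 m5 by auto
    with 3 show ?thesis by simp
  qed
qed

definition lattice_point :: "int \<Rightarrow> int \<Rightarrow> real^2" where
  "lattice_point m n = vector [of_int m, of_int n]"

lemma lattice_point_nth [simp]:
  "lattice_point m n $ 1 = of_int m" "lattice_point m n $ 2 = of_int n"
  by (simp_all add: lattice_point_def)

lemma integer_points_eq: "integer_points = range (\<lambda>(m, n). lattice_point m n)"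
proof (intro set_eqI iffI)
  fix z :: "real^2" assume "z \<in> integer_points"
  then obtain m n where "z $ 1 = of_int m" "z $ 2 = of_int n"
    unfolding integer_points_def by (metis Ints_cases mem_Collect_eq)
  then have "z = lattice_point m n"
    by (simp add: vec_eq_iff forall_2)
  then show "z \<in> range (\<lambda>(m, n). lattice_point m n)" by auto
qed (auto simp: integer_points_def forall_2)

lemma integer_points_add: "z \<in> integer_points \<Longrightarrow> z' \<in> integer_points \<Longrightarrow> z + z' \<in> integer_points"
  by (simp add: integer_points_def)

lemma integer_points_subset_W_set: "integer_points \<subseteq> W_set {z + b |z. z \<in> integer_points}"
proof
  fix w :: "real^2" assume w: "w \<in> integer_points"
  have "\<exists>z'. (z + b) + of_int m *\<^sub>R w = z' + b \<and> z' \<in> integer_points"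
    if "z \<in> integer_points" for z and m :: int
    using that w by (intro exI [of _ "z + of_int m *\<^sub>R w"]) (auto simp: integer_points_def)
  then show "w \<in> W_set {z + b |z. z \<in> integer_points}"
    unfolding W_set_def by auto
qed

section \<open>Normals and gauge of the Type 3 triangle\<close>

locale type3_triangle =
  fixes b :: "real^2" and \<gamma>1 \<gamma>2 \<gamma>3 :: real
  assumes b_notin: "b \<notin> integer_points"
    and b_bounds: "-1 \<le> b$2" "b$2 \<le> b$1" "b$1 \<le> 0"
    and \<gamma>_bounds: "\<gamma>1 > 0" "\<gamma>2 > 0" "\<gamma>3 > 0" "\<gamma>2 < 1" "\<gamma>3 < 1"
begin

abbreviation "q \<equiv> type3_normal b \<gamma>1 \<gamma>2 \<gamma>3"
abbreviation "c \<equiv> type3_height b \<gamma>1 \<gamma>2 \<gamma>3"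
abbreviation "S \<equiv> {z + b |z. z \<in> integer_points}"

text \<open>\<open>d1\<close>, \<open>d2\<close>, \<open>d3\<close> are the denominators in
  \<open>type3_normal\<close>, written out in coordinates.\<close>

definition "d1 = (b$1 + 1) + \<gamma>1 * (b$2 + 1)"
definition "d2 = - b$1 + \<gamma>2 * (b$2 + 1)"
definition "d3 = \<gamma>3 * b$1 - b$2"

definition "e1 = 1 / d1"
definition "e2 = 1 / d2"
definition "e3 = 1 / d3"

text \<open>On the region of admissible \<open>b\<close> the denominators are nonnegative and vanish
  only at its vertices \<open>(-1, -1)\<close>, \<open>(0, -1)\<close> and \<open>(0, 0)\<close>,
  which are integral.\<close>

lemma d_pos: "0 < d1" "0 < d2" "0 < d3"
proof -
  have ne: "b$1 \<noteq> of_int m \<or> b$2 \<noteq> of_int n" for m n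
    using b_notin by (auto simp: integer_points_def forall_2)
  have "0 \<le> \<gamma>1 * (b$2 + 1)" "0 \<le> \<gamma>2 * (b$2 + 1)"
    using b_bounds \<gamma>_bounds by auto
  moreover have "\<gamma>1 * (b$2 + 1) = 0 \<longleftrightarrow> b$2 = -1" "\<gamma>2 * (b$2 + 1) = 0 \<longleftrightarrow> b$2 = -1"
    using \<gamma>_bounds by auto
  moreover have "b$1 + 1 \<noteq> 0 \<or> b$2 \<noteq> -1" "b$1 \<noteq> 0 \<or> b$2 \<noteq> -1"
    using ne [of "-1" "-1"] ne [of 0 "-1"] by auto
  ultimately show "0 < d1" "0 < d2"
    using b_bounds unfolding d1_def d2_def by linarith+
  \<comment> \<open>From \<open>b$2 \<le> b$1\<close> follows
    \<open>d3 \<ge> (\<gamma>3 - 1) * b$1\<close>.\<close>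
  have "0 \<le> (\<gamma>3 - 1) * b$1" "(\<gamma>3 - 1) * b$1 = 0 \<longleftrightarrow> b$1 = 0"
    using b_bounds \<gamma>_bounds by (auto simp: mult_nonpos_nonpos)
  moreover have "b$1 \<noteq> 0 \<or> b$2 \<noteq> 0"
    using ne [of 0 0] by auto
  ultimately show "0 < d3"
    using b_bounds unfolding d3_def left_diff_distrib by linarith
qed

lemma e_pos: "0 < e1" "0 < e2" "0 < e3"
  using d_pos by (simp_all add: e1_def e2_def e3_def)

lemma q_inner:
  "q 1 \<bullet> r = e1 * (r$1 + \<gamma>1 * r$2)"
  "q 2 \<bullet> r = e2 * (- r$1 + \<gamma>2 * r$2)"
  "q 3 \<bullet> r = e3 * (\<gamma>3 * r$1 - r$2)"
  by (simp_all add: type3_normal_def inner_vec_def sum_2 e1_def e2_def e3_def d1_def d2_def d3_def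
      diff_divide_distrib add_divide_distrib algebra_simps)

text \<open>The normals are scaled to take the value 1 at \<open>b + (1, 1)\<close>,
  \<open>b + (0, 1)\<close> and \<open>b\<close> respectively.\<close>

lemma q_inner_b:
  "q 1 \<bullet> b = 1 - e1 * (1 + \<gamma>1)" "q 2 \<bullet> b = 1 - e2 * \<gamma>2" "q 3 \<bullet> b = 1"
proof -
  have "e1 * d1 = 1" "e2 * d2 = 1" "e3 * d3 = 1"
    using d_pos by (simp_all add: e1_def e2_def e3_def)
  then show "q 1 \<bullet> b = 1 - e1 * (1 + \<gamma>1)" "q 2 \<bullet> b = 1 - e2 * \<gamma>2" "q 3 \<bullet> b = 1"
    unfolding q_inner d1_def d2_def d3_def by (simp_all add: algebra_simps)
qed

lemma c_eq: "c 1 = - e1 * \<gamma>1" "c 2 = 0" "c 3 = e3 * (1 - \<gamma>3 / 2)"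
  using d_pos by (simp_all add: type3_height_def inner_vec_def sum_2 e1_def e3_def d1_def d3_def field_simps)

lemma q_inner_lattice_point:
  "q 1 \<bullet> lattice_point z1 z2 = e1 * (z1 + \<gamma>1 * z2)"
  "q 2 \<bullet> lattice_point z1 z2 = e2 * (- z1 + \<gamma>2 * z2)"
  "q 3 \<bullet> lattice_point z1 z2 = e3 * (\<gamma>3 * z1 - z2)"
  by (simp_all add: q_inner)

lemma psi_eq_max: "psi q r = max (q 1 \<bullet> r) (max (q 2 \<bullet> r) (q 3 \<bullet> r))"
  by (intro antisym) (auto simp: psi_le_iff forall_3 psi_ge)

lemma psi_sublevel_bounded:
  "\<exists>K. \<forall>r. psi q r \<le> B \<longrightarrow> \<bar>r$1\<bar> \<le> K \<and> \<bar>r$2\<bar> \<le> K"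
proof -
  \<comment> \<open>Elimination: the sum of the first two inequalities bounds \<open>r$2\<close>
    above, and the third then bounds \<open>r$1\<close> above. The second plus
    \<open>\<gamma>2\<close> times the third bounds \<open>r$1\<close> below, since
    \<open>\<gamma>2 * \<gamma>3 < 1\<close>, and the third then bounds \<open>r$2\<close>
    below.\<close>
  define u2 where "u2 = (B / e1 + B / e2) / (\<gamma>1 + \<gamma>2)"
  define u1 where "u1 = (B / e3 + u2) / \<gamma>3"
  define l1 where "l1 = - (\<gamma>2 * (B / e3) + B / e2) / (1 - \<gamma>2 * \<gamma>3)"
  define l2 where "l2 = \<gamma>3 * l1 - B / e3"
  have "l1 \<le> r$1 \<and> r$1 \<le> u1 \<and> l2 \<le> r$2 \<and> r$2 \<le> u2" if "psi q r \<le> B" for r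
  proof -
    have "e1 * (r$1 + \<gamma>1 * r$2) \<le> B" "e2 * (- r$1 + \<gamma>2 * r$2) \<le> B" "e3 * (\<gamma>3 * r$1 - r$2) \<le> B"
      using that by (simp_all add: psi_eq_max q_inner)
    then have *: "r$1 + \<gamma>1 * r$2 \<le> B / e1" "- r$1 + \<gamma>2 * r$2 \<le> B / e2" "\<gamma>3 * r$1 - r$2 \<le> B / e3"
      using e_pos by (simp_all add: pos_le_divide_eq mult.commute)
    have "(\<gamma>1 + \<gamma>2) * r$2 \<le> B / e1 + B / e2"
      using *(1,2) by (simp add: algebra_simps)
    then have u2: "r$2 \<le> u2"
      using \<gamma>_bounds by (simp add: u2_def pos_le_divide_eq mult.commute)
    then have "\<gamma>3 * r$1 \<le> B / e3 + u2"
      using *(3) by simp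
    then have u1: "r$1 \<le> u1"
      using \<gamma>_bounds by (simp add: u1_def pos_le_divide_eq mult.commute)
    have "\<gamma>2 * (\<gamma>3 * r$1 - r$2) \<le> \<gamma>2 * (B / e3)"
      using *(3) \<gamma>_bounds by (intro mult_left_mono) auto
    then have "- (\<gamma>2 * (B / e3) + B / e2) \<le> (1 - \<gamma>2 * \<gamma>3) * r$1"
      using *(2) by (simp add: algebra_simps)
    moreover have "\<gamma>2 * \<gamma>3 < 1"
      using \<gamma>_bounds by (simp add: mult_less_cancel_left_pos mult_strict_mono [of \<gamma>2 1 \<gamma>3 1, simplified])
    ultimately have l1: "l1 \<le> r$1"
      by (simp add: l1_def pos_divide_le_eq mult.commute)
    then have "\<gamma>3 * l1 \<le> \<gamma>3 * r$1"
      using \<gamma>_bounds by simp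
    then have "l2 \<le> r$2"
      using *(3) by (simp add: l2_def)
    with u1 u2 l1 show ?thesis by simp
  qed
  then show ?thesis
    by (intro exI [of _ "\<bar>l1\<bar> + \<bar>l2\<bar> + \<bar>u1\<bar> + \<bar>u2\<bar>"]) (smt (verit))
qed

text \<open>Only finitely many lattice points do at least as well as 0, because sublevel sets of the
  gauge are bounded.\<close>

lemma nearest_integer_point:
  obtains z0 where "z0 \<in> integer_points" "\<And>z. z \<in> integer_points \<Longrightarrow> psi q (r - z0) \<le> psi q (r - z)"
proof -
  define Z where "Z = {z \<in> integer_points. psi q (r - z) \<le> psi q r}"
  obtain K where K: "\<And>x. psi q x \<le> psi q r \<Longrightarrow> \<bar>x$1\<bar> \<le> K \<and> \<bar>x$2\<bar> \<le> K"
    using psi_sublevel_bounded by blast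
  define N where "N = \<lceil>K + \<bar>r$1\<bar> + \<bar>r$2\<bar>\<rceil>"
  have "Z \<subseteq> (\<lambda>(m, n). lattice_point m n) ` ({-N..N} \<times> {-N..N})"
  proof
    fix z assume z: "z \<in> Z"
    then obtain m n where mn: "z = lattice_point m n"
      unfolding Z_def integer_points_eq by auto
    have "\<bar>r$1 - of_int m\<bar> \<le> K" "\<bar>r$2 - of_int n\<bar> \<le> K"
      using K [of "r - z"] z mn by (auto simp: Z_def)
    then have "\<bar>of_int m\<bar> \<le> K + \<bar>r$1\<bar> + \<bar>r$2\<bar>" "\<bar>of_int n\<bar> \<le> K + \<bar>r$1\<bar> + \<bar>r$2\<bar>"
      by linarith+
    then have "\<bar>m\<bar> \<le> N" "\<bar>n\<bar> \<le> N"
      unfolding N_def by linarith+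
    then show "z \<in> (\<lambda>(m, n). lattice_point m n) ` ({-N..N} \<times> {-N..N})"
      using mn by force
  qed
  then have "finite Z"
    by (rule finite_subset) simp
  moreover have "0 \<in> Z"
    by (simp add: Z_def integer_points_def)
  ultimately obtain z0 where z0: "z0 \<in> Z" "\<And>z. z \<in> Z \<Longrightarrow> psi q (r - z0) \<le> psi q (r - z)"
    using arg_min_if_finite(1) [of Z "\<lambda>z. psi q (r - z)"] arg_min_least [of Z _ "\<lambda>z. psi q (r - z)"]
    by (metis empty_iff)
  then have "psi q (r - z0) \<le> psi q (r - z)" if "z \<in> integer_points" for z
    using that \<open>0 \<in> Z\<close> by (cases "z \<in> Z") (force simp: Z_def)+
  moreover have "z0 \<in> integer_points"
    using z0(1) by (simp add: Z_def)
  ultimately show ?thesis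
    using that by blast
qed

end

section \<open>Lattice-freeness, spindle covering and unique lifting for the pyramid\<close>

locale type3_pyramid = type3_triangle +
  fixes p :: "real^2" and V :: real
  assumes \<gamma>2_ge: "1 \<le> 2 * \<gamma>2"
    and q_inner_p: "\<And>i. q i \<bullet> p = V - c i"
begin

lemma pyramid_free:
  assumes "s \<in> S"
  shows "1 \<le> psi q (s - real n *\<^sub>R p) + real n * V"
proof -
  obtain z1 z2 where s: "s = lattice_point z1 z2 + b"
    using assms unfolding integer_points_eq by auto
  define x1 x2 where "x1 = real_of_int z1" and "x2 = real_of_int z2"
  \<comment> \<open>These are the three facet conditions at height \<open>n\<close> after division
    by the scaling factors; \<open>b\<close> cancels by \<open>q_inner_b\<close>. The refutation of
    their joint failure distinguishes \<open>z2 > n\<close>, \<open>z2 \<le> 0\<close> and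
    \<open>0 < z2 \<le> n\<close>.\<close>
  have "1 + \<gamma>1 \<le> x1 + \<gamma>1 * (x2 - real n) \<or> \<gamma>2 \<le> - x1 + \<gamma>2 * x2 \<or>
      0 \<le> \<gamma>3 * (x1 - real n / 2) - (x2 - real n)"
  proof (rule ccontr)
    assume "\<not> ?thesis"
    then have 1: "x1 - 1 < \<gamma>1 * (1 + real n - x2)" and 2: "\<gamma>2 * (x2 - 1) < x1"
      and 3: "\<gamma>3 * (x1 - real n / 2) < x2 - real n"
      by (simp_all add: algebra_simps)
    show False
    proof (cases "z2 \<le> int n")
      case False
      then have "1 + real n \<le> x2"
        unfolding x2_def by linarith
      then have "\<gamma>1 * (1 + real n - x2) \<le> 0" "0 \<le> \<gamma>2 * (x2 - 1)"
        using \<gamma>_bounds by (auto intro: mult_nonneg_nonpos)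
      then have "0 < z1" "z1 < 1"
        using 1 2 unfolding x1_def by linarith+
      then show False by simp
    next
      case True
      then have "x2 \<le> real n"
        unfolding x2_def by linarith
      then have "\<gamma>3 * (x1 - real n / 2) < 0"
        using 3 by linarith
      then have "x1 - real n / 2 < 0"
        using \<gamma>_bounds by (simp add: mult_less_0_iff)
      then have "1 * (x1 - real n / 2) \<le> \<gamma>3 * (x1 - real n / 2)"
        using \<gamma>_bounds by (intro mult_right_mono_neg) auto
      then have "x1 - real n / 2 < x2 - real n"
        using 3 by (metis mult_1 le_less_trans)
      then have 4: "x1 < x2 - real n / 2"
        by linarith
      show False
      proof (cases "z2 \<le> 0")
        case True
        then have "1 * (x2 - 1) \<le> \<gamma>2 * (x2 - 1)"
          using \<gamma>_bounds by (intro mult_right_mono_neg) (auto simp: x2_def)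
        then have "x2 - 1 < x1"
          using 2 by (metis mult_1 le_less_trans)
        moreover have "x1 < x2"
          using 4 by simp
        ultimately have "z2 - 1 < z1" "z1 < z2"
          unfolding x1_def x2_def by linarith+
        then show False by simp
      next
        case False
        \<comment> \<open>\<open>2 * \<gamma>2 \<ge> 1\<close> enters here: it leads to
          \<open>z2 - 1 < 2 * z1 < 2 * z2 - n \<le> z2\<close>, which no integer
          \<open>2 * z1\<close> satisfies.\<close>
        then have "1 * (x2 - 1) \<le> (2 * \<gamma>2) * (x2 - 1)"
          using \<gamma>2_ge by (intro mult_right_mono) (auto simp: x2_def)
        also have "(2 * \<gamma>2) * (x2 - 1) < 2 * x1"
          using 2 by (simp only: mult.assoc mult_less_cancel_left_pos zero_less_numeral)
        finally have "x2 - 1 < 2 * x1" "2 * x1 < 2 * x2 - real n"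
          using 4 by simp_all
        then have "z2 - 1 < 2 * z1" "2 * z1 < 2 * z2 - int n"
          unfolding x1_def x2_def by linarith+
        then show False using True by linarith
      qed
    qed
  qed
  then consider "e1 * (1 + \<gamma>1) \<le> e1 * (x1 + \<gamma>1 * (x2 - real n))" | "e2 * \<gamma>2 \<le> e2 * (- x1 + \<gamma>2 * x2)" |
      "0 \<le> e3 * (\<gamma>3 * (x1 - real n / 2) - (x2 - real n))"
    using e_pos by fastforce
  then have "\<exists>k. 1 \<le> q k \<bullet> (s - real n *\<^sub>R p) + real n * V"
  proof cases
    case 1 then show ?thesis
      by (intro exI [of _ 1]) (simp add: s x1_def x2_def inner_diff_right inner_add_right q_inner_p c_eq q_inner_b,
        simp add: q_inner algebra_simps)
  next
    case 2 then show ?thesis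
      by (intro exI [of _ 2]) (simp add: s x1_def x2_def inner_diff_right inner_add_right q_inner_p c_eq q_inner_b,
        simp add: q_inner algebra_simps)
  next
    case 3 then show ?thesis
      by (intro exI [of _ 3]) (simp add: s x1_def x2_def inner_diff_right inner_add_right q_inner_p c_eq q_inner_b,
        simp add: q_inner algebra_simps)
  qed
  then show ?thesis
    by (meson add_right_mono order_trans psi_ge)
qed

text \<open>By \<open>q_inner_p\<close> the terms with \<open>V\<close> cancel, so moving to a
  neighbouring pair changes each facet value by an amount in which \<open>b\<close> appears only
  through the scaling factors.\<close>

lemma inner_step:
  "q 1 \<bullet> (r - lattice_point z1 z2 - of_int j *\<^sub>R p) + of_int j * V
     = q 1 \<bullet> r - e1 * (z1 + \<gamma>1 * (z2 + j))"
  "q 2 \<bullet> (r - lattice_point z1 z2 - of_int j *\<^sub>R p) + of_int j * V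
     = q 2 \<bullet> r - e2 * (- z1 + \<gamma>2 * z2)"
  "q 3 \<bullet> (r - lattice_point z1 z2 - of_int j *\<^sub>R p) + of_int j * V
     = q 3 \<bullet> r - e3 * (\<gamma>3 * (z1 + j / 2) - (z2 + j))"
  by (simp add: inner_diff_right q_inner_p c_eq, simp add: q_inner algebra_simps)+

text \<open>Membership in the set of three values suffices: combined with minimality it gives the
  three-way disjunctions that \<open>cell0_cases\<close> and \<open>cell1_cases\<close>
  expect.\<close>

lemma psi_step:
  "psi q (r - lattice_point z1 z2 - of_int j *\<^sub>R p) + of_int j * V
     \<in> {q 1 \<bullet> r - e1 * (z1 + \<gamma>1 * (z2 + j)), q 2 \<bullet> r - e2 * (- z1 + \<gamma>2 * z2),
        q 3 \<bullet> r - e3 * (\<gamma>3 * (z1 + j / 2) - (z2 + j))}"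
proof -
  obtain k where "psi q (r - lattice_point z1 z2 - of_int j *\<^sub>R p)
      = q k \<bullet> (r - lattice_point z1 z2 - of_int j *\<^sub>R p)"
    using psi_attained by blast
  then show ?thesis
    using exhaust_3 [of k] inner_step [of r z1 z2 j] by auto
qed

text \<open>Here \<open>r\<close> is the residual after the translation and \<open>i\<close> copies
  of \<open>p\<close> are removed; \<open>i\<close> remains only to demand
  \<open>i \<le> n\<close>.\<close>

definition covers :: "real^2 \<Rightarrow> nat \<Rightarrow> bool" where
  "covers r i \<longleftrightarrow> (\<exists>x\<in>S. \<exists>n\<ge>i. psi q (x - real n *\<^sub>R p) + real n * V \<le> 1 \<and> r \<in> spindle q (x - real n *\<^sub>R p))"

lemma coversI:
  assumes "i \<le> n" and "x = lattice_point z1 z2 + b - real n *\<^sub>R p"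
    and "q k \<bullet> x + real n * V \<le> 1"
    and "\<forall>i. q i \<bullet> r \<le> q k \<bullet> r" "\<forall>i. q k \<bullet> r - q i \<bullet> r \<le> q k \<bullet> x - q i \<bullet> x"
  shows "covers r i"
proof -
  have *: "q i \<bullet> (x - r) \<le> q k \<bullet> (x - r)" for i
    using assms(5) [rule_format, of i] by (simp add: inner_diff_right)
  have "lattice_point z1 z2 + b \<in> S"
    unfolding integer_points_eq by blast
  then show ?thesis
    unfolding covers_def using assms(1-3) spindleI [where q = q and k = k and r = r and x = x, OF assms(4) [rule_format] *] by fastforce
qed

lemmas tile_simps = forall_3 inner_diff_right inner_add_right q_inner_p c_eq q_inner_b
  q_inner_lattice_point

text \<open>The residual has \<open>i = 0\<close>; it is compared with pairs of both levels, and
  ties are allowed.\<close>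

lemma covers_cell0:
  assumes "\<And>z1 z2. psi q r \<le> psi q (r - lattice_point z1 z2)"
    and "\<And>z1 z2. psi q r \<le> psi q (r - lattice_point z1 z2 - p) + V"
  shows "covers r 0"
proof -
  define A1 A2 A3 g1 g2 g3 where "A1 = q 1 \<bullet> r" and "A2 = q 2 \<bullet> r" and "A3 = q 3 \<bullet> r"
    and "g1 = e1 * \<gamma>1" and "g2 = e2 * \<gamma>2" and "g3 = e3 * \<gamma>3"
  note A_defs = A1_def [symmetric] A2_def [symmetric] A3_def [symmetric]
  have psi: "psi q r = max A1 (max A2 A3)"
    by (simp add: psi_eq_max A_defs)
  have step0: "max A1 (max A2 A3) \<le> A1 - (e1 * z1 + g1 * z2) \<or> max A1 (max A2 A3) \<le> A2 - (g2 * z2 - e2 * z1) \<or>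
      max A1 (max A2 A3) \<le> A3 - (g3 * z1 - e3 * z2)" for z1 z2 :: int
    using psi_step [of r z1 z2 0] assms(1) [of z1 z2] unfolding psi g1_def g2_def g3_def A_defs
    by (auto simp: algebra_simps)
  have step1: "max A1 (max A2 A3) \<le> A1 - (e1 * z1 + g1 * (z2 + 1)) \<or> max A1 (max A2 A3) \<le> A2 - (g2 * z2 - e2 * z1) \<or>
      max A1 (max A2 A3) \<le> A3 - (g3 * (z1 + 1/2) - e3 * (z2 + 1))" for z1 z2 :: int
    using psi_step [of r z1 z2 1] assms(2) [of z1 z2] unfolding psi g1_def g2_def g3_def A_defs
    by (auto simp: algebra_simps)
  have pos: "0 < e1" "0 < g1" "0 < g2" "g2 < e2" "0 < g3" "g3 < e3"
    using e_pos \<gamma>_bounds by (simp_all add: g1_def g2_def g3_def)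
  have "A2 \<le> A1 \<and> A3 \<le> A1 \<and> A1 - A2 \<le> e2 \<and> A1 - A3 \<le> e3 - g3 \<or>
         A2 \<le> A1 \<and> A3 \<le> A1 \<and> A1 - A2 \<le> e2 - g2 \<and> A1 - A3 \<le> e3 - g3/2 \<or>
         A1 \<le> A2 \<and> A3 \<le> A2 \<and> A2 - A1 \<le> e1 \<and> A2 - A3 \<le> e3 \<or>
         A1 \<le> A2 \<and> A3 \<le> A2 \<and> A2 - A1 \<le> e1 + g1 \<and> A2 - A3 \<le> g3/2 \<or>
         A1 \<le> A3 \<and> A2 \<le> A3 \<and> A3 - A1 \<le> e1 + g1 \<and> A3 - A2 \<le> g2"
    by (rule cell0_cases [OF pos])
      (use step0 [of 1 0] step1 [of 0 0] step0 [of 1 1] step0 [of 0 1] step0 [of "-1" "-1"]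
        step1 [of "-1" "-1"] step0 [of 0 "-1"] step1 [of 0 "-1"] in \<open>simp_all add: algebra_simps\<close>)
  then consider
      "A2 \<le> A1" "A3 \<le> A1" "A1 - A2 \<le> e2" "A1 - A3 \<le> e3 - g3" |
      "A2 \<le> A1" "A3 \<le> A1" "A1 - A2 \<le> e2 - g2" "A1 - A3 \<le> e3 - g3/2" |
      "A1 \<le> A2" "A3 \<le> A2" "A2 - A1 \<le> e1" "A2 - A3 \<le> e3" |
      "A1 \<le> A2" "A3 \<le> A2" "A2 - A1 \<le> e1 + g1" "A2 - A3 \<le> g3/2" |
      "A1 \<le> A3" "A2 \<le> A3" "A3 - A1 \<le> e1 + g1" "A3 - A2 \<le> g2"
    by blast
  \<comment> \<open>Each alternative is the spindle of a point \<open>(b + (z1, z2), n)\<close> on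
    facet \<open>k\<close> of the pyramid.\<close>
  then show ?thesis
  proof cases
    case 1
    then show ?thesis
      by (intro coversI [where n = 0 and ?z1.0 = 1 and ?z2.0 = 1 and k = 1, OF _ refl]) (simp_all add: tile_simps A_defs g1_def g2_def g3_def algebra_simps)
  next
    case 2
    then show ?thesis
      by (intro coversI [where n = 1 and ?z1.0 = 1 and ?z2.0 = 2 and k = 1, OF _ refl]) (simp_all add: tile_simps A_defs g1_def g2_def g3_def algebra_simps)
  next
    case 3
    then show ?thesis
      by (intro coversI [where n = 0 and ?z1.0 = 0 and ?z2.0 = 1 and k = 2, OF _ refl]) (simp_all add: tile_simps A_defs g1_def g2_def g3_def algebra_simps)
  next
    case 4
    then show ?thesis
      by (intro coversI [where n = 1 and ?z1.0 = 0 and ?z2.0 = 1 and k = 2, OF _ refl]) (simp_all add: tile_simps A_defs g1_def g2_def g3_def algebra_simps)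
  next
    case 5
    then show ?thesis
      by (intro coversI [where n = 0 and ?z1.0 = 0 and ?z2.0 = 0 and k = 3, OF _ refl]) (simp_all add: tile_simps A_defs g1_def g2_def g3_def algebra_simps)
  qed
qed

text \<open>The residual has \<open>i = 1\<close>, so level 0 is reached by adding \<open>p\<close>
  back; the strict inequality encodes the tie-break in favour of \<open>i = 0\<close>.\<close>

lemma covers_cell1:
  assumes "\<And>z1 z2. psi q r \<le> psi q (r - lattice_point z1 z2)"
    and "\<And>z1 z2. psi q r + V < psi q (r - lattice_point z1 z2 + p)"
  shows "covers r 1"
proof -
  define A1 A2 A3 g1 g2 g3 where "A1 = q 1 \<bullet> r" and "A2 = q 2 \<bullet> r" and "A3 = q 3 \<bullet> r"
    and "g1 = e1 * \<gamma>1" and "g2 = e2 * \<gamma>2" and "g3 = e3 * \<gamma>3"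
  note A_defs = A1_def [symmetric] A2_def [symmetric] A3_def [symmetric]
  have psi: "psi q r = max A1 (max A2 A3)"
    by (simp add: psi_eq_max A_defs)
  have step0: "max A1 (max A2 A3) \<le> A1 - (e1 * z1 + g1 * z2) \<or> max A1 (max A2 A3) \<le> A2 - (g2 * z2 - e2 * z1) \<or>
      max A1 (max A2 A3) \<le> A3 - (g3 * z1 - e3 * z2)" for z1 z2 :: int
    using psi_step [of r z1 z2 0] assms(1) [of z1 z2] unfolding psi g1_def g2_def g3_def A_defs
    by (auto simp: algebra_simps)
  have step1: "max A1 (max A2 A3) < A1 - (e1 * z1 + g1 * (z2 - 1)) \<or> max A1 (max A2 A3) < A2 - (g2 * z2 - e2 * z1) \<or>
      max A1 (max A2 A3) < A3 - (g3 * (z1 - 1/2) - e3 * (z2 - 1))" for z1 z2 :: int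
    using psi_step [of r z1 z2 "-1"] assms(2) [of z1 z2] unfolding psi g1_def g2_def g3_def A_defs
    by (auto simp: algebra_simps)
  have pos: "0 < e1" "0 < g1" "0 < g2" "g2 < e2" "0 < g3" "g3 < e3" "e2 \<le> 2 * g2"
    using e_pos \<gamma>_bounds \<gamma>2_ge mult_left_mono [OF \<gamma>2_ge, of e2] by (simp_all add: g1_def g2_def g3_def)
  have "A2 \<le> A1 \<and> A3 \<le> A1 \<and> A1 - A2 \<le> e2 - g2 \<and> A1 - A3 \<le> e3 - g3/2 \<or>
         A1 \<le> A2 \<and> A3 \<le> A2 \<and> A2 - A1 \<le> e1 + g1 \<and> A2 - A3 \<le> g3/2 \<or>
         A1 \<le> A3 \<and> A2 \<le> A3 \<and> A3 - A1 \<le> g1 \<and> A3 - A2 \<le> e2 - g2"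
    by (rule cell1_cases [OF pos])
      (use step1 [of 1 1] step1 [of 1 2] step0 [of "-1" "-1"] step1 [of 0 1] step1 [of 0 0]
        in \<open>simp_all add: algebra_simps\<close>)
  then consider
      "A2 \<le> A1" "A3 \<le> A1" "A1 - A2 \<le> e2 - g2" "A1 - A3 \<le> e3 - g3/2" |
      "A1 \<le> A2" "A3 \<le> A2" "A2 - A1 \<le> e1 + g1" "A2 - A3 \<le> g3/2" |
      "A1 \<le> A3" "A2 \<le> A3" "A3 - A1 \<le> g1" "A3 - A2 \<le> e2 - g2"
    by blast
  then show ?thesis
  proof cases
    case 1
    then show ?thesis
      by (intro coversI [where n = 1 and ?z1.0 = 1 and ?z2.0 = 2 and k = 1, OF _ refl])
        (simp_all add: tile_simps A_defs g1_def g2_def g3_def algebra_simps)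
  next
    case 2
    then show ?thesis
      by (intro coversI [where n = 1 and ?z1.0 = 0 and ?z2.0 = 1 and k = 2, OF _ refl])
        (simp_all add: tile_simps A_defs g1_def g2_def g3_def algebra_simps)
  next
    case 3
    then show ?thesis
      by (intro coversI [where n = 2 and ?z1.0 = 1 and ?z2.0 = 2 and k = 3, OF _ refl])
        (simp_all add: tile_simps A_defs g1_def g2_def g3_def algebra_simps)
  qed
qed

text \<open>The minimum over pairs is found by minimising over the lattice for \<open>i = 0\<close>
  and for \<open>i = 1\<close> separately and comparing the two costs.\<close>

lemma covering: "\<exists>w\<in>integer_points. \<exists>i. covers (r - w - real i *\<^sub>R p) i"
proof -
  obtain w0 where w0: "w0 \<in> integer_points"
    "\<And>z. z \<in> integer_points \<Longrightarrow> psi q (r - w0) \<le> psi q (r - z)"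
    using nearest_integer_point [of r] by blast
  obtain w1 where w1: "w1 \<in> integer_points"
    "\<And>z. z \<in> integer_points \<Longrightarrow> psi q (r - p - w1) \<le> psi q (r - p - z)"
    using nearest_integer_point [of "r - p"] by blast
  have lat: "lattice_point m n \<in> integer_points" for m n
    unfolding integer_points_eq by blast
  show ?thesis
  proof (cases "psi q (r - w0) \<le> psi q (r - p - w1) + V")
    case True
    have "covers (r - w0) 0"
    proof (rule covers_cell0)
      fix z1 z2
      show "psi q (r - w0) \<le> psi q (r - w0 - lattice_point z1 z2)"
        using w0(2) [OF integer_points_add [OF w0(1) lat]] by (simp add: algebra_simps)
      show "psi q (r - w0) \<le> psi q (r - w0 - lattice_point z1 z2 - p) + V"
        using True w1(2) [OF integer_points_add [OF w0(1) lat [of z1 z2]]] by (simp add: algebra_simps)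
    qed
    then show ?thesis
      using w0(1) by (intro bexI [of _ w0] exI [of _ 0]) auto
  next
    case False
    have "covers (r - p - w1) 1"
    proof (rule covers_cell1)
      fix z1 z2
      show "psi q (r - p - w1) \<le> psi q (r - p - w1 - lattice_point z1 z2)"
        using w1(2) [OF integer_points_add [OF w1(1) lat]] by (simp add: algebra_simps)
      show "psi q (r - p - w1) + V < psi q (r - p - w1 - lattice_point z1 z2 + p)"
        using False w0(2) [OF integer_points_add [OF w1(1) lat [of z1 z2]]] by (simp add: algebra_simps)
    qed
    moreover have "r - p - w1 = r - w1 - real 1 *\<^sub>R p"
      by simp
    ultimately show ?thesis
      using w1(1) by metis
  qed
qed

lemma V_val_eq: "V_val S (psi q) p = V"
  and ex1_L_set: "\<exists>!\<pi>. \<pi> \<in> L_set S (psi q) p"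
proof -
  \<comment> \<open>The point \<open>(b + (1, 2), 1)\<close> lies on the first facet and serves as
    the tight point at positive height.\<close>
  let ?x0 = "lattice_point 1 2 + b"
  have x0: "?x0 \<in> S"
    unfolding integer_points_eq by blast
  have "q i \<bullet> (?x0 - real 1 *\<^sub>R p) \<le> q 1 \<bullet> (?x0 - real 1 *\<^sub>R p)" for i
    using exhaust_3 [of i] e_pos \<gamma>_bounds
    by (auto simp: tile_simps algebra_simps)
  then have "psi q (?x0 - real 1 *\<^sub>R p) = q 1 \<bullet> (?x0 - real 1 *\<^sub>R p)"
    by (intro antisym psi_ge) (simp add: psi_le_iff)
  then have tight: "psi q (?x0 - real 1 *\<^sub>R p) + real 1 * V = 1"
    by (simp add: tile_simps algebra_simps)
  have "\<exists>w\<in>W_set S. \<exists>x\<in>S. \<exists>n. \<exists>i\<le>n. psi q (x - real n *\<^sub>R p) + real n * V \<le> 1 \<and>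
                  r - w - real i *\<^sub>R p \<in> spindle q (x - real n *\<^sub>R p)" for r
    using covering [of r] integer_points_subset_W_set [of b] unfolding covers_def by blast
  note * = unique_minimal_lifting [OF pyramid_free x0 _ tight this]
  show "V_val S (psi q) p = V" "\<exists>!\<pi>. \<pi> \<in> L_set S (psi q) p"
    by (rule *; simp)+
qed

text \<open>\<open>Delta\<close> is defined through \<open>V_val\<close>, so the covering passes to
  \<open>X_region\<close> only once \<open>V_val_eq\<close> is known.\<close>

lemma X_region_covering: "{x + w |x w. x \<in> X_region S q p \<and> w \<in> W_set S} = UNIV"
proof -
  have "\<exists>x w. r = x + w \<and> x \<in> X_region S q p \<and> w \<in> W_set S" for r
  proof -
    obtain w i where w: "w \<in> integer_points" and "covers (r - w - real i *\<^sub>R p) i"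
      using covering by blast
    then obtain x n where x: "x \<in> S" "i \<le> n" "psi q (x - real n *\<^sub>R p) + real n * V \<le> 1"
      and mem: "r - w - real i *\<^sub>R p \<in> spindle q (x - real n *\<^sub>R p)"
      unfolding covers_def by auto
    have "q k \<bullet> x + (V - q k \<bullet> p) * real n \<le> 1" for k
      using x(3) psi_ge [of q k "x - real n *\<^sub>R p"] by (simp add: inner_diff_right algebra_simps)
    then have "(x, real n) \<in> Delta S q p"
      by (simp add: Delta_def V_val_eq)
    moreover have "r - w \<in> (\<lambda>r. r + real i *\<^sub>R p) ` spindle q (x - real n *\<^sub>R p)"
      using mem by (intro image_eqI [where x = "r - w - real i *\<^sub>R p"]) auto
    ultimately have "r - w \<in> X_region S q p"
      unfolding X_region_def using x(1,2) by fastforce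
    then show ?thesis
      using w integer_points_subset_W_set [of b] by (intro exI [of _ "r - w"] exI [of _ w]) auto
  qed
  then show ?thesis by blast
qed

end

section \<open>The pyramid over the Type 3 triangle\<close>

context type3_triangle
begin

text \<open>Positive coefficients of the linear relation between the three normals: 2 by 2
  determinants of the unscaled normals, times the denominators.\<close>

definition "\<mu>1 = d1 * (1 - \<gamma>2 * \<gamma>3)"
definition "\<mu>2 = d2 * (1 + \<gamma>1 * \<gamma>3)"
definition "\<mu>3 = d3 * (\<gamma>1 + \<gamma>2)"

definition "apex_det = \<gamma>2 * (2 - \<gamma>3 + 2 * \<gamma>1 * \<gamma>3) - \<gamma>1 * \<gamma>3"

lemma \<mu>_pos: "0 < \<mu>1" "0 < \<mu>2" "0 < \<mu>3"
proof -
  have "\<gamma>2 * \<gamma>3 < 1 * 1"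
    using \<gamma>_bounds by (intro mult_strict_mono) auto
  moreover have "0 < 1 + \<gamma>1 * \<gamma>3"
    using \<gamma>_bounds by (simp add: add_pos_pos)
  ultimately show "0 < \<mu>1" "0 < \<mu>2" "0 < \<mu>3"
    using d_pos \<gamma>_bounds by (simp_all add: \<mu>1_def \<mu>2_def \<mu>3_def)
qed

lemma d_mult_e: "d1 * (e1 * t) = t" "d2 * (e2 * t) = t" "d3 * (e3 * t) = t"
  using d_pos by (simp_all add: e1_def e2_def e3_def)

lemma weighted_normals: "\<mu>1 * (q 1 \<bullet> x) + \<mu>2 * (q 2 \<bullet> x) + \<mu>3 * (q 3 \<bullet> x) = 0"
proof -
  have "\<mu>1 * (q 1 \<bullet> x) = (1 - \<gamma>2 * \<gamma>3) * (d1 * (q 1 \<bullet> x))"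
    "\<mu>2 * (q 2 \<bullet> x) = (1 + \<gamma>1 * \<gamma>3) * (d2 * (q 2 \<bullet> x))"
    "\<mu>3 * (q 3 \<bullet> x) = (\<gamma>1 + \<gamma>2) * (d3 * (q 3 \<bullet> x))"
    by (simp_all add: \<mu>1_def \<mu>2_def \<mu>3_def)
  then show ?thesis
    unfolding q_inner d_mult_e by (simp add: algebra_simps)
qed

lemma weighted_heights: "\<mu>1 * c 1 + \<mu>2 * c 2 + \<mu>3 * c 3 = apex_det / 2"
proof -
  have "\<mu>1 * c 1 = (1 - \<gamma>2 * \<gamma>3) * - (d1 * (e1 * \<gamma>1))"
    "\<mu>3 * c 3 = (\<gamma>1 + \<gamma>2) * (d3 * (e3 * (1 - \<gamma>3 / 2)))"
    by (simp_all add: \<mu>1_def \<mu>3_def c_eq)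
  then show ?thesis
    unfolding d_mult_e by (simp add: c_eq apex_det_def field_simps)
qed

text \<open>The weights eliminate \<open>x\<close>. The case \<open>u = 1\<close> determines the
  height of the apex, the case \<open>u = 0\<close> gives its uniqueness.\<close>

lemma weighted_facets:
  assumes "\<And>i. q i \<bullet> x + c i * t = u"
  shows "t * apex_det / 2 = (\<mu>1 + \<mu>2 + \<mu>3) * u"
proof -
  have "(\<mu>1 + \<mu>2 + \<mu>3) * u
      = \<mu>1 * (q 1 \<bullet> x + c 1 * t) + \<mu>2 * (q 2 \<bullet> x + c 2 * t) + \<mu>3 * (q 3 \<bullet> x + c 3 * t)"
    unfolding assms by (simp add: algebra_simps)
  also have "\<dots> = (\<mu>1 * (q 1 \<bullet> x) + \<mu>2 * (q 2 \<bullet> x) + \<mu>3 * (q 3 \<bullet> x)) + (\<mu>1 * c 1 + \<mu>2 * c 2 + \<mu>3 * c 3) * t"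
    by (simp add: algebra_simps)
  finally show ?thesis
    unfolding weighted_normals weighted_heights by simp
qed

text \<open>Nonpositive terms in a vanishing sum with positive weights are all zero, and two
  independent normals determine \<open>x\<close>.\<close>

lemma q_inner_nonpos_imp_zero:
  assumes "\<And>i. q i \<bullet> x \<le> 0"
  shows "x = 0"
proof -
  have le: "\<mu>1 * (q 1 \<bullet> x) \<le> 0" "\<mu>2 * (q 2 \<bullet> x) \<le> 0" "\<mu>3 * (q 3 \<bullet> x) \<le> 0"
    using \<mu>_pos assms by (simp_all add: mult_le_0_iff)
  then have "\<mu>1 * (q 1 \<bullet> x) = 0" "\<mu>2 * (q 2 \<bullet> x) = 0"
    using weighted_normals [of x] by linarith+
  then have *: "x$1 + \<gamma>1 * x$2 = 0" "- x$1 + \<gamma>2 * x$2 = 0"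
    using \<mu>_pos e_pos by (simp_all add: q_inner)
  then have "(\<gamma>1 + \<gamma>2) * x$2 = 0"
    by (simp add: algebra_simps)
  then have "x$2 = 0"
    using \<gamma>_bounds by simp
  with * show ?thesis
    by (simp add: vec_eq_iff forall_2)
qed

lemma apex_exists:
  assumes "0 < apex_det"
  obtains a where "is_apex q c a" "0 < snd a"
proof -
  \<comment> \<open>The height is forced by \<open>weighted_facets\<close>, and \<open>y\<close>
    solves the sum of the first two facet equations. The third equation follows from the linear
    relation between the normals.\<close>
  define h where "h = 2 * (\<mu>1 + \<mu>2 + \<mu>3) / apex_det"
  define y where "y = (d1 * (1 - c 1 * h) + d2 * (1 - c 2 * h)) / (\<gamma>1 + \<gamma>2)"
  define x :: "real^2" where "x = vector [\<gamma>2 * y - d2 * (1 - c 2 * h), y]"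
  have "(\<gamma>1 + \<gamma>2) * y = d1 * (1 - c 1 * h) + d2 * (1 - c 2 * h)"
    using \<gamma>_bounds by (simp add: y_def)
  then have "x$1 + \<gamma>1 * x$2 = d1 * (1 - c 1 * h)" "- x$1 + \<gamma>2 * x$2 = d2 * (1 - c 2 * h)"
    by (simp_all add: x_def algebra_simps)
  then have 1: "q 1 \<bullet> x = 1 - c 1 * h" and 2: "q 2 \<bullet> x = 1 - c 2 * h"
    using d_pos by (simp_all add: q_inner e1_def e2_def)
  have "h * (\<mu>1 * c 1 + \<mu>2 * c 2 + \<mu>3 * c 3) = \<mu>1 + \<mu>2 + \<mu>3"
    unfolding weighted_heights using assms by (simp add: h_def)
  then have "\<mu>3 * (q 3 \<bullet> x) = \<mu>3 * (1 - c 3 * h)"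
    using weighted_normals [of x] unfolding 1 2 by (simp add: algebra_simps)
  then have 3: "q 3 \<bullet> x = 1 - c 3 * h"
    using \<mu>_pos by simp
  have eq: "q i \<bullet> x + c i * h = 1" for i
    using exhaust_3 [of i] 1 2 3 by auto
  have "x' = x \<and> h' = h" if "\<And>i. q i \<bullet> x' + c i * h' = 1" for x' h'
  proof -
    have diff: "q i \<bullet> (x' - x) + c i * (h' - h) = 0" for i
      using that [of i] eq [of i] by (simp add: inner_diff_right algebra_simps)
    then have "h' = h"
      using weighted_facets [OF diff] assms by simp
    then show ?thesis
      using q_inner_nonpos_imp_zero [of "x' - x"] diff by simp
  qed
  then have "is_apex q c (x, h)"
    unfolding is_apex_def using eq by blast
  moreover have "0 < h"
    using assms \<mu>_pos by (simp add: h_def)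
  ultimately show ?thesis
    using that by simp
qed

text \<open>A point at height \<open>u * h\<close> with \<open>u < 1\<close> becomes, after
  \<open>u\<close> times the apex is subtracted and the rest is divided by \<open>1 - u\<close>, a
  point of the base triangle.\<close>

lemma pyramid_eq_hull:
  assumes apex: "\<And>i. q i \<bullet> x0 + c i * h = 1" and "0 < h"
  shows "pyramid q c = convex hull (triangle q \<times> {0} \<union> {(x0, h)})"
proof (rule antisym)
  have "convex (pyramid q c)"
  proof (rule convexI)
    fix y z and u v :: real
    assume "y \<in> pyramid q c" "z \<in> pyramid q c" and uv: "0 \<le> u" "0 \<le> v" "u + v = 1"
    moreover obtain x s x' s' where "y = (x, s)" "z = (x', s')"
      by fastforce
    ultimately have *: "0 \<le> s" "0 \<le> s'" "\<And>i. q i \<bullet> x + c i * s \<le> 1" "\<And>i. q i \<bullet> x' + c i * s' \<le> 1"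
      and yz: "y = (x, s)" "z = (x', s')"
      by (auto simp: pyramid_def)
    have "u * (q i \<bullet> x + c i * s) + v * (q i \<bullet> x' + c i * s') \<le> 1" for i
      using * uv by (intro convex_bound_le) auto
    then show "u *\<^sub>R y + v *\<^sub>R z \<in> pyramid q c"
      using * uv by (simp add: yz pyramid_def inner_add_right algebra_simps)
  qed
  moreover have "triangle q \<times> {0} \<union> {(x0, h)} \<subseteq> pyramid q c"
    using assms by (auto simp: pyramid_def triangle_def)
  ultimately show "convex hull (triangle q \<times> {0} \<union> {(x0, h)}) \<subseteq> pyramid q c"
    by (rule hull_minimal [rotated])
next
  show "pyramid q c \<subseteq> convex hull (triangle q \<times> {0} \<union> {(x0, h)})" (is "_ \<subseteq> ?H")
  proof
    fix z assume "z \<in> pyramid q c"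
    then obtain x t where z: "z = (x, t)" "0 \<le> t" "\<And>i. q i \<bullet> x + c i * t \<le> 1"
      by (auto simp: pyramid_def)
    define u where "u = t / h"
    have t: "t = u * h" and "0 \<le> u"
      using \<open>0 < h\<close> \<open>0 \<le> t\<close> by (auto simp: u_def)
    have le: "q i \<bullet> (x - u *\<^sub>R x0) \<le> 1 - u" for i
    proof -
      have "q i \<bullet> (x - u *\<^sub>R x0) = (q i \<bullet> x + c i * t) - u * (q i \<bullet> x0 + c i * h)"
        by (simp add: inner_diff_right t algebra_simps)
      then show ?thesis
        using z(3) [of i] by (simp add: apex)
    qed
    have apex_in: "(x0, h) \<in> ?H"
      by (simp add: hull_inc)
    show "z \<in> ?H"
    proof (cases "u < 1")
      case True
      define y where "y = (1 / (1 - u)) *\<^sub>R (x - u *\<^sub>R x0)"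
      have "y \<in> triangle q"
        using le True by (simp add: triangle_def y_def)
      then have "(y, 0) \<in> ?H"
        by (simp add: hull_inc)
      then have "(1 - u) *\<^sub>R (y, 0) + u *\<^sub>R (x0, h) \<in> ?H"
        using apex_in True \<open>0 \<le> u\<close> by (intro convexD [OF convex_convex_hull]) auto
      moreover have "(1 - u) *\<^sub>R (y, 0) + u *\<^sub>R (x0, h) = z"
        using True by (simp add: z(1) t y_def)
      ultimately show ?thesis by simp
    next
      case False
      \<comment> \<open>For \<open>u \<ge> 1\<close> all three normals are nonpositive on the
        residue, which leaves only the apex itself.\<close>
      then have "x - u *\<^sub>R x0 = 0"
        using le by (intro q_inner_nonpos_imp_zero) (meson diff_le_0_iff_le le_less_trans not_le)
      with le [of 1] False have "u = 1" "x = x0"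
        by auto
      then show ?thesis
        using apex_in by (simp add: z(1) t)
    qed
  qed
qed

lemma is_apex_inner:
  assumes "is_apex q c a"
  shows "q i \<bullet> fst a + c i * snd a = 1"
proof -
  have "a \<in> {(x, x3). \<forall>i. q i \<bullet> x + c i * x3 = 1}"
    using assms unfolding is_apex_def by simp
  then show ?thesis by auto
qed

lemma pyramid_with_apex_iff:
  "(\<exists>a. is_pyramid_with_apex q c a \<and> snd a > 0) \<longleftrightarrow> apex_det > 0"
proof
  assume "\<exists>a. is_pyramid_with_apex q c a \<and> snd a > 0"
  then obtain a where a: "is_apex q c a" "snd a > 0"
    unfolding is_pyramid_with_apex_def by blast
  then have "snd a * apex_det / 2 = \<mu>1 + \<mu>2 + \<mu>3"
    using weighted_facets [OF is_apex_inner [OF a(1)]] by simp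
  moreover have "0 < \<mu>1 + \<mu>2 + \<mu>3"
    using \<mu>_pos by simp
  ultimately have "0 < snd a * apex_det"
    by simp
  with a(2) show "apex_det > 0"
    by (simp add: zero_less_mult_iff)
next
  assume "apex_det > 0"
  then obtain a where a: "is_apex q c a" "0 < snd a"
    using apex_exists by blast
  with pyramid_eq_hull [OF is_apex_inner [OF a(1)] a(2)]
  have "is_pyramid_with_apex q c a"
    by (simp add: is_pyramid_with_apex_def)
  with a(2) show "\<exists>a. is_pyramid_with_apex q c a \<and> snd a > 0"
    by blast
qed

lemma free_imp_\<gamma>2_ge:
  assumes "free_of (pyramid q c) (S \<times> \<int>)"
  shows "1 \<le> 2 * \<gamma>2"
proof (rule ccontr)
  assume less: "\<not> ?thesis"
  let ?x = "lattice_point 1 3 + b"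
  define U where "U = {z :: (real^2) \<times> real. 0 < snd z} \<inter> (\<Inter>i. {z. q i \<bullet> fst z + c i * snd z < 1})"
  have "open U"
    unfolding U_def
    by (intro open_Int open_INT ballI open_Collect_less continuous_intros finite)
  moreover have "U \<subseteq> pyramid q c"
    by (auto simp: U_def pyramid_def less_imp_le)
  ultimately have "U \<subseteq> interior (pyramid q c)"
    by (rule interior_maximal [rotated])
  moreover have "q i \<bullet> ?x + c i * 3 < 1" for i
  proof -
    \<comment> \<open>The slacks of the three facets at \<open>(?x, 3)\<close> are
      \<open>e1 * \<gamma>1\<close>, \<open>e2 * (1 - 2 * \<gamma>2)\<close> and
      \<open>e3 * \<gamma>3 / 2\<close>.\<close>
    have "e2 * (2 * \<gamma>2) < e2 * 1" "0 < e1 * \<gamma>1" "0 < e3 * \<gamma>3"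
      using less e_pos \<gamma>_bounds by (simp_all del: mult_1_right)
    then have "\<forall>i. q i \<bullet> ?x + c i * 3 < 1"
      by (simp add: forall_3 inner_add_right q_inner_b q_inner_lattice_point c_eq algebra_simps)
    then show ?thesis ..
  qed
  then have "(?x, 3) \<in> U"
    by (simp add: U_def)
  moreover have "?x \<in> S"
    unfolding integer_points_eq by blast
  then have "(?x, 3) \<in> S \<times> \<int>"
    by simp
  ultimately show False
    using assms unfolding free_of_def by blast
qed

end

theorem proposition4p1:
  fixes b :: "real^2" and S :: "(real^2) set" and \<gamma>1 \<gamma>2 \<gamma>3 :: real
    and q :: "3 \<Rightarrow> real^2" and c :: "3 \<Rightarrow> real"
  assumes "b \<notin> integer_points"
    and "-1 \<le> b$2" "b$2 \<le> b$1" "b$1 \<le> 0"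
    and "S = {z + b |z. z \<in> integer_points}"
    and "\<gamma>1 > 0" "\<gamma>2 > 0" "\<gamma>3 > 0" "\<gamma>2 < 1" "\<gamma>3 < 1"
    and "q = type3_normal b \<gamma>1 \<gamma>2 \<gamma>3"
    and "c = type3_height b \<gamma>1 \<gamma>2 \<gamma>3"
  shows "((\<exists>a. is_pyramid_with_apex q c a \<and> snd a > 0) \<longleftrightarrow>
            \<gamma>2 * (2 - \<gamma>3 + 2 * \<gamma>1 * \<gamma>3) - \<gamma>1 * \<gamma>3 > 0)
       \<and> (\<forall>a p. is_pyramid_with_apex q c a \<and> snd a > 0 \<and>
               free_of (pyramid q c) (S \<times> \<int>) \<and> p = (1 / snd a) *\<^sub>R fst a \<longrightarrow>
            {x + w |x w. x \<in> X_region S q p \<and> w \<in> W_set S} = UNIV \<and>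
            (\<exists>!\<pi>. \<pi> \<in> L_set S (psi q) p))"
proof -
  interpret T: type3_triangle b \<gamma>1 \<gamma>2 \<gamma>3
    using assms by unfold_locales
  note eqs = \<open>S = _\<close> \<open>q = _\<close> \<open>c = _\<close>
  show ?thesis
  proof (intro conjI allI impI)
    show "(\<exists>a. is_pyramid_with_apex q c a \<and> snd a > 0) \<longleftrightarrow>
        \<gamma>2 * (2 - \<gamma>3 + 2 * \<gamma>1 * \<gamma>3) - \<gamma>1 * \<gamma>3 > 0"
      using T.pyramid_with_apex_iff unfolding eqs T.apex_det_def .
  next
    fix a p
    assume a: "is_pyramid_with_apex q c a \<and> snd a > 0 \<and>
               free_of (pyramid q c) (S \<times> \<int>) \<and> p = (1 / snd a) *\<^sub>R fst a"
    interpret P: type3_pyramid b \<gamma>1 \<gamma>2 \<gamma>3 p "1 / snd a"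
    proof
      show "1 \<le> 2 * \<gamma>2"
        using a T.free_imp_\<gamma>2_ge unfolding eqs by blast
      \<comment> \<open>This is the facet equation at the apex divided by its height.\<close>
      show "type3_normal b \<gamma>1 \<gamma>2 \<gamma>3 i \<bullet> p = 1 / snd a - type3_height b \<gamma>1 \<gamma>2 \<gamma>3 i" for i
        using a T.is_apex_inner [of a i] unfolding eqs is_pyramid_with_apex_def
        by (auto simp: field_simps)
    qed
    show "{x + w |x w. x \<in> X_region S q p \<and> w \<in> W_set S} = UNIV"
      using P.X_region_covering unfolding eqs .
    show "\<exists>!\<pi>. \<pi> \<in> L_set S (psi q) p"
      using P.ex1_L_set unfolding eqs .
  qed
qed

end
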